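(* Let $p\ge 29$ be a prime such that $\lfloor 2\sqrt{2p}\rfloor$ is odd, and write $\lfloor 2\sqrt{2p}\rfloor-2=4k+r$ with integers $k\ge 0$ and $r\in\{1,3\}$. Put $f_{r,c}(t)=2t^2+(r+3)t+c$, $C_1=\{-3,-1,1\}$, $C_3=\{-1,1,3\}$, and $(k_{1,-3},k_{1,-1},k_{1,1})=(5,3,3)$, $(k_{3,-1},k_{3,1},k_{3,3})=(7,3,3)$. Then $p$ is exceptional if and only if $p=f_{r,c}(n)$ for some $c\in C_r$ and some integer $n\ge k_{r,c}$.
   Context: For an odd prime $p$, $D_{2p}=\langle x,y\mid x^p=y^2=1,\ y^{-1}xy=x^{-1}\rangle$ is the dihedral group of order $2p$. A Cayley subset of a finite group $G$ is a subset $S\subset G\setminus\{1\}$ with $S=S^{-1}$ generating $G$; it is normal if it is a union of conjugacy classes. The Cayley graph $X(S)$ has vertex set $G$, with $g,h$ adjacent iff $g^{-1}h\in S$; it is connected and $|S|$-regular. A connected $k$-regular graph is Ramanujan if $\mu\le 2\sqrt{k-1}$, where $\mu$ is the maximum of $|\lambda|$ over adjacency eigenvalues $\lambda$ with $|\lambda|\ne k$. For $G=D_{2p}$ let $\widetilde{\mathcal{S}}$ be the set of all Cayley subsets, $\widetilde{\mathcal{L}}=\{2p-|S|:S\in\widetilde{\mathcal{S}}\}$, and $\tilde{l}=\max\{l\in\widetilde{\mathcal{L}}:\ X(S)$ is Ramanujan for every $S\in\widetilde{\mathcal{S}}$ with $1\le 2p-|S|\le l\}$. Let $\hat{l}=2\lfloor\sqrt{2p}-\tfrac12\rfloor-1$.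 The prime $p$ is called exceptional if $\lfloor 2\sqrt{2p}\rfloor$ is odd and $\tilde{l}=\hat{l}+1$, and ordinary otherwise. *)

theory Defs
  imports
    "HOL-Algebra.Generated_Groups"
    "HOL-Computational_Algebra.Primes"
    "Graph_Theory.Pair_Digraph"
    "Graph_Theory.Digraph_Component"
    "Jordan_Normal_Form.Char_Poly"
begin

text \<open>The pair \<open>(i, b)\<close> stands for \<open>x\<^sup>i\<close> if \<open>b\<close> is false and for \<open>x\<^sup>i y\<close> if \<open>b\<close> is true;
  the product follows from \<open>y x\<^sup>j = x\<^sup>-\<^sup>j y\<close>.\<close>

definition dihedral :: "nat \<Rightarrow> (int \<times> bool) monoid" where
  "dihedral p = \<lparr>carrier = {0..<int p} \<times> UNIV,
     monoid.mult = (\<lambda>(i, a) (j, b). ((if a then i - j else i + j) mod int p, a \<noteq> b)),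
     one = (0, False)\<rparr>"

lemma group_dihedral:
  assumes "p > 0"
  shows "group (dihedral p)"
proof (rule groupI)
  fix g h k
  assume "g \<in> carrier (dihedral p)" "h \<in> carrier (dihedral p)" "k \<in> carrier (dihedral p)"
  then show "g \<otimes>\<^bsub>dihedral p\<^esub> h \<otimes>\<^bsub>dihedral p\<^esub> k
      = g \<otimes>\<^bsub>dihedral p\<^esub> (h \<otimes>\<^bsub>dihedral p\<^esub> k)"
    by (auto simp: dihedral_def mod_simps algebra_simps split: prod.splits)
next
  fix g assume g: "g \<in> carrier (dihedral p)"
  obtain i a where ia: "g = (i, a)" by fastforce
  show "\<exists>h\<in>carrier (dihedral p). h \<otimes>\<^bsub>dihedral p\<^esub> g = \<one>\<^bsub>dihedral p\<^esub>"
    using g assms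
    by (intro bexI[of _ "(if a then i else (- i) mod int p, a)"])
       (auto simp: dihedral_def ia mod_simps)
qed (use assms in \<open>auto simp: dihedral_def\<close>)

lemma order_dihedral: "Coset.order (dihedral p) = 2 * p"
  by (simp add: Coset.order_def dihedral_def card_cartesian_product)

lemma dihedral_pow_x:
  assumes "p > 1"
  shows "(1, False) [^]\<^bsub>dihedral p\<^esub> (n::nat) = (int n mod int p, False)"
  by (induction n) (auto simp: dihedral_def nat_pow_def mod_simps algebra_simps)

lemma dihedral_relations:
  assumes "p > 1"
  shows "(1, False) [^]\<^bsub>dihedral p\<^esub> p = \<one>\<^bsub>dihedral p\<^esub>"
    and "(0, True) [^]\<^bsub>dihedral p\<^esub> (2::nat) = \<one>\<^bsub>dihedral p\<^esub>"
    and "inv\<^bsub>dihedral p\<^esub> (0, True) \<otimes>\<^bsub>dihedral p\<^esub> (1, False) \<otimes>\<^bsub>dihedral p\<^esub> (0, True)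
      = inv\<^bsub>dihedral p\<^esub> (1, False)"
proof -
  interpret group "dihedral p" using assms by (intro group_dihedral) simp
  show "(1, False) [^]\<^bsub>dihedral p\<^esub> p = \<one>\<^bsub>dihedral p\<^esub>"
    using assms by (simp add: dihedral_pow_x) (simp add: dihedral_def)
  show "(0, True) [^]\<^bsub>dihedral p\<^esub> (2::nat) = \<one>\<^bsub>dihedral p\<^esub>"
    using assms by (simp add: numeral_2_eq_2) (simp add: dihedral_def)
  have y: "inv\<^bsub>dihedral p\<^esub> (0, True) = (0, True)"
    using assms by (intro inv_equality) (auto simp: dihedral_def)
  have x: "inv\<^bsub>dihedral p\<^esub> (1, False) = (int p - 1, False)"
    using assms by (intro inv_equality) (auto simp: dihedral_def)
  show "inv\<^bsub>dihedral p\<^esub> (0, True) \<otimes>\<^bsub>dihedral p\<^esub> (1, False) \<otimes>\<^bsub>dihedral p\<^esub> (0, True)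
      = inv\<^bsub>dihedral p\<^esub> (1, False)"
    unfolding x y using assms by (auto simp: dihedral_def zmod_minus1)
qed

definition cayley_subset :: "('a, 'b) monoid_scheme \<Rightarrow> 'a set \<Rightarrow> bool" where
  "cayley_subset G S \<longleftrightarrow>
     S \<subseteq> carrier G - {\<one>\<^bsub>G\<^esub>} \<and> m_inv G ` S = S \<and> generate G S = carrier G"

definition cayley_graph :: "('a, 'b) monoid_scheme \<Rightarrow> 'a set \<Rightarrow> 'a pair_pre_digraph" where
  "cayley_graph G S = \<lparr>pverts = carrier G,
     parcs = {(g, h). g \<in> carrier G \<and> h \<in> carrier G \<and> inv\<^bsub>G\<^esub> g \<otimes>\<^bsub>G\<^esub> h \<in> S}\<rparr>"

text \<open>The adjacency matrix depends on an enumeration \<open>vs\<close> of the vertices; its eigenvalues do not.\<close>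

definition adj_matrix :: "'a pair_pre_digraph \<Rightarrow> 'a list \<Rightarrow> complex mat" where
  "adj_matrix X vs = mat (length vs) (length vs) (\<lambda>(i, j). of_bool ((vs ! i, vs ! j) \<in> parcs X))"

definition adj_eigenvalue :: "'a pair_pre_digraph \<Rightarrow> complex \<Rightarrow> bool" where
  "adj_eigenvalue X l \<longleftrightarrow>
     (\<exists>vs. distinct vs \<and> set vs = pverts X \<and> eigenvalue (adj_matrix X vs) l)"

lemma eigenvalue_adj_matrix_iff:
  assumes vs: "distinct vs" "set vs = pverts X"
  shows "eigenvalue (adj_matrix X vs) l \<longleftrightarrow>
    (\<exists>f. (\<exists>v\<in>pverts X. f v \<noteq> 0) \<and>
         (\<forall>v\<in>pverts X. (\<Sum>w\<in>pverts X. of_bool ((v, w) \<in> parcs X) * f w) = l * f v))"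
    (is "_ \<longleftrightarrow> (\<exists>f. ?P f)")
proof -
  let ?n = "length vs"
  have bij: "bij_betw ((!) vs) {..<?n} (pverts X)"
    using vs by (intro bij_betw_nth) auto
  have sum_eq: "(\<Sum>w\<in>pverts X. g w) = (\<Sum>j<?n. g (vs ! j))" for g :: "_ \<Rightarrow> complex"
    using sum.reindex_bij_betw[OF bij, of g] by simp
  have ball_eq: "(\<forall>v\<in>pverts X. Q v) \<longleftrightarrow> (\<forall>i<?n. Q (vs ! i))" for Q
    using vs by (metis all_set_conv_all_nth)
  have P: "?P f \<longleftrightarrow> eigenvector (adj_matrix X vs) (vec ?n (\<lambda>i. f (vs ! i))) l" for f
  proof -
    have "(\<exists>v\<in>pverts X. f v \<noteq> 0) \<longleftrightarrow> \<not> (\<forall>i<?n. f (vs ! i) = 0)"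
      using ball_eq[of "\<lambda>v. f v = 0"] by blast
    then show ?thesis
      by (auto simp: eigenvector_def adj_matrix_def ball_eq sum_eq vec_eq_iff scalar_prod_def
          atLeast0LessThan)
  qed
  have "\<exists>f. v = vec ?n (\<lambda>i. f (vs ! i))" if v: "eigenvector (adj_matrix X vs) v l" for v
  proof (intro exI)
    have "dim_vec v = ?n" using v by (simp add: eigenvector_def adj_matrix_def)
    then show "v = vec ?n (\<lambda>i. (v $ inv_into {..<?n} ((!) vs) (vs ! i)))"
      using bij by (auto simp: vec_eq_iff bij_betw_def inv_into_f_f)
  qed
  then show ?thesis
    unfolding eigenvalue_def P by metis
qed

definition regular_graph :: "'a pair_pre_digraph \<Rightarrow> nat \<Rightarrow> bool" where
  "regular_graph X k \<longleftrightarrow> (\<forall>v\<in>pverts X. out_degree (with_proj X) v = k)"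

text \<open>The inserted \<open>0\<close> only matters if every eigenvalue has modulus \<open>k\<close>,
  where the maximum would otherwise be taken over the empty set.\<close>

definition graph_mu :: "'a pair_pre_digraph \<Rightarrow> nat \<Rightarrow> real" where
  "graph_mu X k = Max (insert 0 {cmod l |l. adj_eigenvalue X l \<and> cmod l \<noteq> real k})"

definition ramanujan :: "'a pair_pre_digraph \<Rightarrow> bool" where
  "ramanujan X \<longleftrightarrow> pair_graph X \<and> Digraph_Component.connected (with_proj X) \<and>
     (\<exists>k. regular_graph X k \<and> graph_mu X k \<le> 2 * sqrt (real k - 1))"

definition dihedral_covalencies :: "nat \<Rightarrow> nat set" where
  "dihedral_covalencies p = {2 * p - card S |S. cayley_subset (dihedral p) S}"

definition l_tilde :: "nat \<Rightarrow> nat" where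
  "l_tilde p = Max {l \<in> dihedral_covalencies p.
     \<forall>S. cayley_subset (dihedral p) S \<and> 1 \<le> 2 * p - card S \<and> 2 * p - card S \<le> l \<longrightarrow>
       ramanujan (cayley_graph (dihedral p) S)}"

definition l_hat :: "nat \<Rightarrow> int" where
  "l_hat p = 2 * \<lfloor>sqrt (2 * real p) - 1 / 2\<rfloor> - 1"

definition exceptional :: "nat \<Rightarrow> bool" where
  "exceptional p \<longleftrightarrow> odd \<lfloor>2 * sqrt (2 * real p)\<rfloor> \<and> int (l_tilde p) = l_hat p + 1"

definition f_poly :: "int \<Rightarrow> int \<Rightarrow> int \<Rightarrow> int" where
  "f_poly r c t = 2 * t\<^sup>2 + (r + 3) * t + c"

text \<open>The next two are only meant for \<open>r\<close> equal to \<open>1\<close> or \<open>3\<close> and \<open>c \<in> C_set r\<close>.\<close>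

definition C_set :: "int \<Rightarrow> int set" where
  "C_set r = (if r = 1 then {-3, -1, 1} else {-1, 1, 3})"

definition k_min :: "int \<Rightarrow> int \<Rightarrow> int" where
  "k_min r c = (if r = 1 then (if c = -3 then 5 else 3) else (if c = -1 then 7 else 3))"

end

theory Submission
  imports Defs "HOL-Analysis.Analysis"
begin

text \<open>
  Let the complement of \<open>S\<close> consist of \<open>a\<close> rotations, with exponents \<open>A\<close>, and \<open>b\<close> reflections,
  with exponents \<open>B\<close>. Since \<open>A\<close> is symmetric and contains \<open>0\<close>, \<open>a\<close> is odd. Besides
  \<open>|S|\<close> and \<open>b - a\<close> the eigenvalues of \<open>X(S)\<close> are \<open>- \<alpha>\<^sub>j \<plusminus> |\<beta>\<^sub>j|\<close> for \<open>0 < j < p\<close>, where \<open>\<alpha>\<^sub>j\<close> and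
  \<open>\<beta>\<^sub>j\<close> are the sums of \<open>\<zeta>\<^sup>j\<^sup>i\<close> over \<open>A\<close> and \<open>B\<close> and \<open>\<zeta>\<close> is a primitive \<open>p\<close>-th root of unity.

  The trivial bound \<open>a + b\<close> for the nontrivial eigenvalues shows that every covalency up to
  \<open>l = \<lfloor>2\<surd>(2p)\<rfloor> - 2\<close> is Ramanujan, and the eigenvalue \<open>b - a\<close> with \<open>b = 0\<close> shows that \<open>l + 2\<close> is
  not. Hence \<open>p\<close> is exceptional iff all graphs of covalency \<open>l + 1\<close> are Ramanujan. A sum of \<open>b\<close>
  distinct \<open>p\<close>-th roots of unity has modulus at most \<open>sin(\<pi>b/p) / sin(\<pi>/p)\<close>, with equality for
  consecutive ones, so the worst graph of covalency \<open>l + 1 = a + b\<close> has intervals \<open>A\<close>, \<open>B\<close> of odd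
  and nearly equal lengths. Writing \<open>p = f\<^bsub>r,c\<^esub>(k)\<close>, the Ramanujan condition for it becomes
  \<open>sin\<^sup>2((2k+1)\<pi>/p) \<le> ((2k+1)\<^sup>2 + 2c - 4) sin\<^sup>2(\<pi>/p)\<close> for \<open>r = 1\<close>, and
  \<open>sin\<^sup>2((2k+2)\<pi>/p) cos\<^sup>2(\<pi>/p) \<le> ((2k+2)\<^sup>2 + 2c - 9) sin\<^sup>2(\<pi>/p)\<close> for \<open>r = 3\<close>. To leading order both
  sides differ by a constant, \<open>4\<pi>\<^sup>2/3 = 13.16\<dots>\<close> against \<open>4 - 2c\<close> or \<open>9 - 2c\<close>, which
  separates \<open>c \<ge> -3\<close> from \<open>c \<le> -5\<close>, and \<open>c \<ge> -1\<close> from \<open>c \<le> -3\<close>.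
\<close>

section \<open>Trigonometric estimates\<close>

text \<open>Bounding the cosine in the Lagrange remainder of order 4, 6 or 8 by 1 or -1 gives
  inequalities for every real x, so no smallness has to be checked later.\<close>

lemma cos_taylor_bounds:
  fixes x :: real
  shows "cos x \<le> 1 - x^2/2 + x^4/24"
    and "1 - x^2/2 + x^4/24 - x^6/720 \<le> cos x"
    and "cos x \<le> 1 - x^2/2 + x^4/24 - x^6/720 + x^8/40320"
proof -
  obtain t where t: "cos x = (\<Sum>m<4. cos_coeff m * x ^ m) + cos (t + 1/2 * real 4 * pi) / fact 4 * x ^ 4"
    using Maclaurin_cos_expansion[of x 4] by blast
  have "cos (t + 1/2 * real 4 * pi) / fact 4 * x ^ 4 \<le> 1 / fact 4 * x ^ 4"
    by (intro mult_right_mono divide_right_mono) auto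
  then show "cos x \<le> 1 - x^2/2 + x^4/24"
    using t by (simp add: lessThan_nat_numeral lessThan_Suc cos_coeff_def fact_numeral)
  obtain t where t: "cos x = (\<Sum>m<6. cos_coeff m * x ^ m) + cos (t + 1/2 * real 6 * pi) / fact 6 * x ^ 6"
    using Maclaurin_cos_expansion[of x 6] by blast
  have "- 1 / fact 6 * x ^ 6 \<le> cos (t + 1/2 * real 6 * pi) / fact 6 * x ^ 6"
    by (intro mult_right_mono divide_right_mono) auto
  then show "1 - x^2/2 + x^4/24 - x^6/720 \<le> cos x"
    using t by (simp add: lessThan_nat_numeral lessThan_Suc cos_coeff_def fact_numeral)
  obtain t where t: "cos x = (\<Sum>m<8. cos_coeff m * x ^ m) + cos (t + 1/2 * real 8 * pi) / fact 8 * x ^ 8"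
    using Maclaurin_cos_expansion[of x 8] by blast
  have "cos (t + 1/2 * real 8 * pi) / fact 8 * x ^ 8 \<le> 1 / fact 8 * x ^ 8"
    by (intro mult_right_mono divide_right_mono) auto
  then show "cos x \<le> 1 - x^2/2 + x^4/24 - x^6/720 + x^8/40320"
    using t by (simp add: lessThan_nat_numeral lessThan_Suc cos_coeff_def fact_numeral)
qed

text \<open>By sin^2 x = (1 - cos 2x)/2 each cosine bound turns into one of the opposite
  direction.\<close>

lemma sin_squared_taylor_bounds:
  fixes x :: real
  shows "x^2 - x^4/3 \<le> (sin x)^2"
    and "(sin x)^2 \<le> x^2 - x^4/3 + 2*x^6/45"
    and "x^2 - x^4/3 + 2*x^6/45 - x^8/315 \<le> (sin x)^2"
  using cos_taylor_bounds[of "2 * x"] cos_double_sin[of x] by (simp_all add: power_mult_distrib)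

lemma sin_multiple_squared_taylor_bounds:
  fixes a x :: real
  shows "x^2 * (a^2 - a^4 * x^2 / 3) \<le> (sin (a * x))^2"
    and "(sin (a * x))^2 \<le> x^2 * (a^2 - a^4 * x^2 / 3 + 2 * a^6 * x^4 / 45)"
    and "x^2 * (a^2 - a^4 * x^2 / 3 + 2 * a^6 * x^4 / 45 - a^8 * x^6 / 315) \<le> (sin (a * x))^2"
proof -
  have "x^2 * (a^2 - a^4 * x^2 / 3) = (a * x)^2 - (a * x)^4 / 3"
    "x^2 * (a^2 - a^4 * x^2 / 3 + 2 * a^6 * x^4 / 45) = (a * x)^2 - (a * x)^4 / 3 + 2 * (a * x)^6 / 45"
    "x^2 * (a^2 - a^4 * x^2 / 3 + 2 * a^6 * x^4 / 45 - a^8 * x^6 / 315)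
      = (a * x)^2 - (a * x)^4 / 3 + 2 * (a * x)^6 / 45 - (a * x)^8 / 315"
    by Groebner_Basis.algebra+
  then show "x^2 * (a^2 - a^4 * x^2 / 3) \<le> (sin (a * x))^2"
    "(sin (a * x))^2 \<le> x^2 * (a^2 - a^4 * x^2 / 3 + 2 * a^6 * x^4 / 45)"
    "x^2 * (a^2 - a^4 * x^2 / 3 + 2 * a^6 * x^4 / 45 - a^8 * x^6 / 315) \<le> (sin (a * x))^2"
    using sin_squared_taylor_bounds[of "a * x"] by (simp_all only:)
qed

text \<open>The numbers 157/150 and 22/21 enclose pi/3: the Taylor bounds put the cosine above 1/2
  at the first and below 1/2 at the second. Hence 3.14 < pi < 22/7.\<close>

lemma pi_squared_bounds: "pi^2 > (985/100 :: real)" "pi^2 < (494/50 :: real)"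
proof -
  have "pi > 471/150"
  proof (rule ccontr)
    assume "\<not> ?thesis"
    then have "cos (157/150) \<le> cos (pi / 3)"
      using pi_ge_two by (intro cos_monotone_0_pi_le) auto
    with cos_taylor_bounds(2)[of "157/150"] show False
      by (simp add: cos_60 power_divide)
  qed
  moreover have "pi < 22/7"
  proof (rule ccontr)
    assume "\<not> ?thesis"
    then have "cos (pi / 3) \<le> cos (22/21)"
      by (intro cos_monotone_0_pi_le) auto
    with cos_taylor_bounds(3)[of "22/21"] show False
      by (simp add: cos_60 power_divide)
  qed
  ultimately have "(471/150)^2 < pi^2" "pi^2 < (22/7)^2"
    by (auto intro!: power_strict_mono)
  then show "pi^2 > (985/100 :: real)" "pi^2 < (494/50 :: real)"
    by (auto simp: power_divide)
qed

text \<open>The polynomial condition is what remains of the Taylor estimate after multiplication by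
  \<open>45 P\<^sup>4\<close> and, with \<open>24625 = 2500 \<cdot> 9.85\<close> and \<open>494 = 50 \<cdot> 9.88\<close>, insertion of the bounds for
  \<open>\<pi>\<^sup>2\<close>.\<close>

lemma sin_multiple_le:
  fixes a d P :: real
  assumes P: "P > 0" and d: "0 \<le> d" "d \<le> a^2" and a: "a \<ge> 1"
    and *: "0 \<le> 15 * 24625 * (a^4 - a^2) * P^2 - 2 * 494^2 * a^6 - 2500 * 45 * d * P^4"
  shows "(sin (a * (pi / P)))^2 \<le> (a^2 - d) * (sin (pi / P))^2"
proof -
  define w where "w = (pi / P)^2"
  have w: "w > 0" "P^2 * w = pi^2" using P by (auto simp: w_def power_divide)
  have a2: "a^2 \<le> a^4" using a by (intro power_increasing) auto
  \<comment> \<open>This compares the sixth order upper bound for sin^2(a pi/P) with a^2 - d times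
    the fourth order lower bound for sin^2(pi/P), divided by \<open>w\<close>; the favourable term
    d*w/3 has been dropped.\<close>
  have "d + 2 * a^6 * w^2 / 45 \<le> (a^4 - a^2) * w / 3"
  proof -
    have "2 * a^6 * (pi^2)^2 \<le> 2 * a^6 * (494/50)^2"
      using pi_squared_bounds a by (intro mult_left_mono power_mono) auto
    moreover have "15 * (a^4 - a^2) * P^2 * (985/100) \<le> 15 * (a^4 - a^2) * P^2 * pi^2"
      using pi_squared_bounds a2 by (intro mult_left_mono) auto
    ultimately have "45 * d * P^4 + 2 * a^6 * (pi^2)^2 \<le> 15 * (a^4 - a^2) * P^2 * pi^2"
      using * by (simp add: power_divide algebra_simps)
    then have "(d + 2 * a^6 * w^2 / 45) * (45 * P^4) \<le> ((a^4 - a^2) * w / 3) * (45 * P^4)"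
      unfolding w(2)[symmetric] by (simp add: field_simps power_mult_distrib flip: power_mult power_add)
    then show ?thesis by (rule mult_right_le_imp_le) (use P in simp)
  qed
  then have "w * (a^2 - a^4 * w / 3 + 2 * a^6 * w^2 / 45) \<le> w * (a^2 - d - a^2 * w / 3)"
    using w by (intro mult_left_mono) (auto simp: algebra_simps)
  also have "\<dots> \<le> w * (a^2 - d - (a^2 - d) * w / 3)"
  proof -
    have "(a^2 - d) * w \<le> a^2 * w" using w d by (intro mult_right_mono) auto
    then show ?thesis using w by (intro mult_left_mono) auto
  qed
  also have "\<dots> = (a^2 - d) * ((pi / P)^2 - (pi / P)^4 / 3)"
    by (simp add: w_def algebra_simps flip: power_mult power_add)
  also have "\<dots> \<le> (a^2 - d) * (sin (pi / P))^2"
    using d sin_squared_taylor_bounds(1)[of "pi / P"] by (intro mult_left_mono) auto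
  finally show ?thesis
    using sin_multiple_squared_taylor_bounds(2)[of a "pi / P"]
    by (simp add: w_def flip: power_mult)
qed

text \<open>The method of \<open>sin_multiple_le\<close>, with the squared cosine bounded by 1 - s,
  where s = w - w^2/3 is the lower bound for sin^2(pi/P).\<close>

lemma sin_cos_multiple_le:
  fixes q d P :: real
  assumes P: "P \<ge> 4" and d: "0 \<le> d" "d \<le> q^2" and q: "q \<ge> 1"
    and *: "0 \<le> 15 * 24625 * (q^4 + 2 * q^2) * P^2 - 494^2 * (15 * q^2 + 15 * q^4 + 2 * q^6)
       - 2500 * 45 * d * P^4"
  shows "(sin (q * (pi / P)))^2 * (cos (pi / P))^2 \<le> (q^2 - d) * (sin (pi / P))^2"
proof -
  define w where "w = (pi / P)^2"
  have w: "w > 0" "P^2 * w = pi^2" using P by (auto simp: w_def power_divide)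
  have "pi / P \<le> 1" using P pi_less_4 by simp
  then have w1: "w \<le> 1" using P unfolding w_def by (intro power_le_one) auto
  have key: "d + w^2 * (q^2 / 3 + q^4 / 3 + 2 * q^6 / 45) \<le> (q^4 + 2 * q^2) * w / 3"
  proof -
    define U V where "U = 15 * q^2 + 15 * q^4 + 2 * q^6" and "V = (q^4 + 2 * q^2) * P^2"
    have "U \<ge> 0" "V \<ge> 0" using q by (auto simp: U_def V_def)
    then have "U * (pi^2)^2 \<le> U * (494/50)^2" "V * (985/100) \<le> V * pi^2"
      using pi_squared_bounds by (intro mult_left_mono power_mono; simp)+
    moreover have "0 \<le> 15 * 24625 * V - 494^2 * U - 2500 * (45 * d * P^4)"
      using * by (simp add: U_def V_def algebra_simps)
    ultimately have "45 * d * P^4 + U * (pi^2)^2 \<le> 15 * V * pi^2"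
      by (simp add: power_divide)
    then have "45 * d * P^4 + (15 * q^2 + 15 * q^4 + 2 * q^6) * (pi^2)^2 \<le> 15 * (q^4 + 2 * q^2) * P^2 * pi^2"
      by (simp add: U_def V_def algebra_simps)
    then have "(d + w^2 * (q^2 / 3 + q^4 / 3 + 2 * q^6 / 45)) * (45 * P^4) \<le> ((q^4 + 2 * q^2) * w / 3) * (45 * P^4)"
      unfolding w(2)[symmetric] by (simp add: field_simps power_mult_distrib flip: power_mult power_add)
    then show ?thesis by (rule mult_right_le_imp_le) (use P in simp)
  qed
  define s where "s = w - w^2 / 3"
  have s: "s \<le> (sin (pi / P))^2"
    using sin_squared_taylor_bounds(1)[of "pi / P"] by (simp add: s_def w_def flip: power_mult)
  define T where "T = q^2 - q^4 * w / 3 + 2 * q^6 * w^2 / 45"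
  have T: "(sin (q * (pi / P)))^2 \<le> w * T"
    using sin_multiple_squared_taylor_bounds(2)[of q "pi / P"]
    by (simp add: w_def T_def flip: power_mult)
  have s1: "1 - s \<ge> 0" using w1 zero_le_power2[of w] unfolding s_def by linarith
  have "(sin (q * (pi / P)))^2 * (cos (pi / P))^2 \<le> (w * T) * (1 - s)"
  proof (rule mult_mono)
    show "(cos (pi / P))^2 \<le> 1 - s" using s by (simp add: cos_squared_eq)
  qed (use T in \<open>auto intro: order_trans[OF zero_le_power2]\<close>)
  also have "\<dots> = w * (T * (1 - s))" by simp
  also have "\<dots> \<le> w * ((q^2 - d) * (1 - w / 3))"
  proof (intro mult_left_mono)
    \<comment> \<open>The factor 1 - s is kept at q^2, lowered to 1 - w at the negative term and
      raised to 1 at the positive one.\<close>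
    have "T * (1 - s) \<le> q^2 * (1 - s) - q^4 * w / 3 * (1 - w) + 2 * q^6 * w^2 / 45"
    proof -
      define A B where "A = q^4 * w / 3" and "B = 2 * q^6 * w^2 / 45"
      have "A * (1 - w) \<le> A * (1 - s)"
        using w by (intro mult_left_mono) (auto simp: s_def A_def)
      moreover have "B * (1 - s) \<le> B * 1"
        using w w1 by (intro mult_left_mono) (auto simp: s_def B_def power2_eq_square mult_left_le)
      moreover have "T * (1 - s) = q^2 * (1 - s) - A * (1 - s) + B * (1 - s)"
        by (simp add: T_def A_def B_def algebra_simps)
      ultimately show ?thesis unfolding A_def[symmetric] B_def[symmetric] by linarith
    qed
    also have "\<dots> \<le> q^2 - d - q^2 * w / 3"
      using key by (simp add: s_def field_simps power2_eq_square)
    also have "\<dots> \<le> (q^2 - d) * (1 - w / 3)"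
      using d w by (simp add: algebra_simps)
    finally show "T * (1 - s) \<le> (q^2 - d) * (1 - w / 3)" .
  qed (use w in auto)
  also have "\<dots> = (q^2 - d) * s" by (simp add: s_def algebra_simps power2_eq_square)
  also have "\<dots> \<le> (q^2 - d) * (sin (pi / P))^2"
    using s d by (intro mult_left_mono) auto
  finally show ?thesis .
qed

text \<open>For the strict reverse inequality the fourth order lower bound of the right side against
  sin x <= x on the left suffices. The hypothesis is a^4 pi^2 / 3 < d P^2 with pi^2 replaced by
  494/50.\<close>

lemma less_sin_multiple:
  fixes a d P :: real
  assumes P: "P \<ge> 4" and *: "494 * a^4 < 150 * d * P^2"
  shows "(a^2 - d) * (sin (pi / P))^2 < (sin (a * (pi / P)))^2"
proof -
  define w where "w = (pi / P)^2"
  have w: "w > 0" "P^2 * w = pi^2" using P by (auto simp: w_def power_divide)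
  have sw: "(sin (pi / P))^2 \<le> w" 
    using abs_sin_x_le_abs_x[of "pi / P"] unfolding w_def by (rule abs_le_square_iff[THEN iffD1])
  have "sin (pi / P) > 0" using P by (intro sin_gt_zero) (auto simp: field_simps)
  then have sp: "(sin (pi / P))^2 > 0" by simp
  have "a^4 * pi^2 \<le> a^4 * (494/50)"
    using pi_squared_bounds by (intro mult_left_mono) auto
  also have "\<dots> < 3 * d * P^2" using * by simp
  finally have "(a^4 * w) * P^2 < (3 * d) * P^2" by (simp add: algebra_simps flip: w(2))
  then have key: "a^4 * w / 3 < d" using P by (simp add: mult_less_cancel_right)
  \<comment> \<open>The upper bound for sin^2 may only be inserted if its factor a^2 - d is
    nonnegative; otherwise the left side is negative.\<close>
  show ?thesis
  proof (cases "a^2 < d")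
    case True
    then have "(a^2 - d) * (sin (pi / P))^2 < 0" using sp by (simp add: mult_neg_pos)
    then show ?thesis by (smt (verit) zero_le_power2)
  next
    case False
    then have "(a^2 - d) * (sin (pi / P))^2 \<le> (a^2 - d) * w"
      using sw by (intro mult_left_mono) auto
    also have "\<dots> < (a^2 - a^4 * w / 3) * w" using key w by (intro mult_strict_right_mono) auto
    also have "\<dots> \<le> (sin (a * (pi / P)))^2"
      using sin_multiple_squared_taylor_bounds(1)[of "pi / P" a] by (simp add: w_def mult.commute)
    finally show ?thesis .
  qed
qed

text \<open>The Taylor polynomial \<open>T\<close> is left open, since the fourth order one serves
  in general and the eighth order one for two small primes. The squared cosine is bounded below by 1
  - (pi/P)^2.\<close>

lemma less_sin_cos_multiple_aux:
  fixes q d P T :: real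
  assumes P: "P \<ge> 4" and T: "(pi / P)^2 * T \<le> (sin (q * (pi / P)))^2"
    and T': "q^2 - d < T * (1 - (pi / P)^2)"
  shows "(q^2 - d) * (sin (pi / P))^2 < (sin (q * (pi / P)))^2 * (cos (pi / P))^2"
proof -
  define w where "w = (pi / P)^2"
  have w: "w > 0" using P by (auto simp: w_def power_divide)
  have sw: "(sin (pi / P))^2 \<le> w" 
    using abs_sin_x_le_abs_x[of "pi / P"] unfolding w_def by (rule abs_le_square_iff[THEN iffD1])
  have "sin (pi / P) > 0" "cos (pi / P) > 0"
    using P by (auto intro!: sin_gt_zero cos_gt_zero simp: field_simps)
  then have sp: "(sin (pi / P))^2 > 0" "(cos (pi / P))^2 > 0" by auto
  show ?thesis
  proof (cases "q^2 < d")
    case True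
    then have "(q^2 - d) * (sin (pi / P))^2 < 0" using sp by (simp add: mult_neg_pos)
    moreover have "0 \<le> (sin (q * (pi / P)))^2 * (cos (pi / P))^2" by simp
    ultimately show ?thesis by linarith
  next
    case False
    then have "(q^2 - d) * (sin (pi / P))^2 \<le> (q^2 - d) * w"
      using sw by (intro mult_left_mono) auto
    also have "\<dots> < T * (1 - w) * w" using T' w by (intro mult_strict_right_mono) (auto simp: w_def)
    also have "\<dots> = (w * T) * (1 - w)" by simp
    also have "\<dots> \<le> (sin (q * (pi / P)))^2 * (cos (pi / P))^2"
    proof (rule mult_mono)
      show "1 - w \<le> (cos (pi / P))^2" using sw by (simp add: cos_squared_eq)
      have "pi / P \<le> 1" using P pi_less_4 by simp
      then show "0 \<le> 1 - w" using P unfolding w_def by (simp add: power_le_one)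
    qed (use T in \<open>auto simp: w_def\<close>)
    finally show ?thesis .
  qed
qed

lemma less_sin_cos_multiple:
  fixes q d P :: real
  assumes P: "P \<ge> 4" and *: "494 * (q^4 + 3 * q^2) < 150 * d * P^2"
  shows "(q^2 - d) * (sin (pi / P))^2 < (sin (q * (pi / P)))^2 * (cos (pi / P))^2"
proof (rule less_sin_cos_multiple_aux[OF P])
  define w where "w = (pi / P)^2"
  have w: "w > 0" "P^2 * w = pi^2" using P by (auto simp: w_def power_divide)
  have "(q^4 + 3 * q^2) * pi^2 \<le> (q^4 + 3 * q^2) * (494/50)"
    using pi_squared_bounds by (intro mult_left_mono) auto
  also have "\<dots> < 3 * d * P^2" using * by simp
  finally have "((q^4 + 3 * q^2) * w) * P^2 < (3 * d) * P^2" by (simp add: algebra_simps flip: w(2))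
  then have "(q^4 + 3 * q^2) * w / 3 < d" using P by (simp add: mult_less_cancel_right)
  moreover have "0 \<le> q^4 * w / 3 * w" using w by simp
  ultimately have "q^2 - d < (q^2 - q^4 * w / 3) * (1 - w)" by (simp add: field_simps)
  then show "q^2 - d < (q^2 - q^4 * (pi / P)^2 / 3) * (1 - (pi / P)^2)" by (simp add: w_def)
  show "(pi / P)^2 * (q^2 - q^4 * (pi / P)^2 / 3) \<le> (sin (q * (pi / P)))^2"
    by (rule sin_multiple_squared_taylor_bounds)
qed

text \<open>These are the primes \<open>f\<^bsub>3,-1\<^esub>(5)\<close> and \<open>f\<^bsub>3,-1\<^esub>(6)\<close> which force
  \<open>k\<^bsub>3,-1\<^esub> = 7\<close>. The fourth order Taylor bound of the preceding lemma is not sharp enough for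
  them.\<close>

lemma less_sin_cos_multiple_79_107:
  fixes q P :: real
  assumes "(q = 12 \<and> P = 79) \<or> (q = 14 \<and> P = 107)"
  shows "(q^2 - 11) * (sin (pi / P))^2 < (sin (q * (pi / P)))^2 * (cos (pi / P))^2"
proof -
  define w where "w = pi^2"
  have w: "985/100 < w" "w < 494/50" using pi_squared_bounds by (auto simp: w_def)
  have w2: "(985/100)^2 < w^2" "w^2 < (494/50)^2" "w^3 < (494/50)^3"
    using w by (auto intro!: power_strict_mono)
  define T where "T = q^2 - q^4 * (pi / P)^2 / 3 + 2 * q^6 * (pi / P)^4 / 45 - q^8 * (pi / P)^6 / 315"
  have T_eq: "T = q^2 - q^4 * w / P^2 / 3 + 2 * q^6 * w^2 / P^4 / 45 - q^8 * w^3 / P^6 / 315"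
    by (simp add: T_def w_def power_divide flip: power_mult)
  \<comment> \<open>Each power of \<open>w\<close> is replaced by the rational bound that makes its
    term smallest, so that only rational arithmetic remains. The 11 in the claim is 9 - 2c at c =
    -1.\<close>
  define T0 where "T0 = q^2 - q^4 * (494/50) / P^2 / 3 + 2 * q^6 * (985/100)^2 / P^4 / 45
    - q^8 * (494/50)^3 / P^6 / 315"
  have T0: "T0 \<le> T"
    unfolding T_eq T0_def
    by (intro diff_mono add_mono divide_right_mono mult_left_mono) (use w w2 in auto)
  have "q^2 - 11 < T0 * (1 - 494/50 / P^2)"
    using assms by (auto simp: T0_def power_divide)
  also have "\<dots> \<le> T * (1 - w / P^2)"
  proof (rule mult_mono)
    show "0 \<le> T" using T0 assms by (auto simp: T0_def power_divide)
  qed (use T0 w assms in \<open>auto simp: divide_right_mono\<close>)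
  finally have less: "q^2 - 11 < T * (1 - (pi / P)^2)" by (simp add: w_def power_divide)
  have "(pi / P)^2 * T \<le> (sin (q * (pi / P)))^2"
    unfolding T_def by (rule sin_multiple_squared_taylor_bounds)
  then show ?thesis
    using assms less by (intro less_sin_cos_multiple_aux) auto
qed

section \<open>The trigonometric inequalities along the polynomial families\<close>

text \<open>Apply \<open>sin_multiple_le\<close> with a = 2k+1 and d = 4 - 2c. Once k is written as
  its least admissible value plus m, the polynomial condition has only positive coefficients in
  m.\<close>

lemma sin_odd_multiple_le:
  fixes k c :: real
  assumes "c = -3 \<and> k \<ge> 5 \<or> c = -1 \<and> k \<ge> 3 \<or> c = 1 \<and> k \<ge> 3"
  defines "P \<equiv> 2 * k^2 + 4 * k + c"
  shows "(sin ((2 * k + 1) * (pi / P)))^2 \<le> ((2 * k + 1)^2 + 2 * c - 4) * (sin (pi / P))^2"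
proof -
  have k3: "k \<ge> 3" using assms by auto
  then have "k^2 \<ge> 3^2" by (intro power_mono) auto
  then have P: "P > 0" using assms k3 by (auto simp: P_def)
  have "(2 * k + 1)^2 \<ge> 7^2" using k3 by (intro power_mono) auto
  then have d: "0 \<le> 4 - 2 * c" "4 - 2 * c \<le> (2 * k + 1)^2" using assms(1) by auto
  have "0 \<le> 15 * 24625 * ((2 * k + 1)^4 - (2 * k + 1)^2) * P^2 - 2 * 494^2 * (2 * k + 1)^6
      - 2500 * 45 * (4 - 2 * c) * P^4"
    using assms(1)
  proof (elim disjE conjE)
    assume c: "c = -3" and "k \<ge> 5"
    then obtain m where k: "k = 5 + m" and m: "m \<ge> 0" by (intro that[of "k - 5"]) auto
    have "15*24625*((2*(5+m)+1)^4
        - (2*(5+m)+1)^2)*(2*(5+m)^2+4*(5+m)+(-3))^2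
        - 2*494^2*(2*(5+m)+1)^6
        - 2500*45*10*(2*(5+m)^2+4*(5+m)+(-3))^4
      = 541305479608 + 1405546268436*m + 1342953898380*m^2 + 668553676880*m^3
        + 195619089120*m^4 + 34966041936*m^5 + 3759473392*m^6 + 223440000*m^7 + 5640000*m^8"
      (is "?l = ?r") by Groebner_Basis.algebra
    moreover have "?r \<ge> 0" using m by simp
    ultimately have "?l \<ge> 0" by (simp only:)
    then show ?thesis by (simp add: P_def c k)
  next
    assume c: "c = -1" and "k \<ge> 3"
    then obtain m where k: "k = 3 + m" and m: "m \<ge> 0" by (intro that[of "k - 3"]) auto
    have "15*24625*((2*(3+m)+1)^4
        - (2*(3+m)+1)^2)*(2*(3+m)^2+4*(3+m)+(-1))^2
        - 2*494^2*(2*(3+m)+1)^6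
        - 2500*45*6*(2*(3+m)^2+4*(3+m)+(-1))^4
      = 195799712272 + 497887569252*m + 544287075180*m^2 + 334633158640*m^3
        + 126606413280*m^4 + 30174761232*m^5 + 4420673392*m^6 + 363600000*m^7 + 12840000*m^8"
      (is "?l = ?r") by Groebner_Basis.algebra
    moreover have "?r \<ge> 0" using m by simp
    ultimately have "?l \<ge> 0" by (simp only:)
    then show ?thesis by (simp add: P_def c k)
  next
    assume c: "c = 1" and "k \<ge> 3"
    then obtain m where k: "k = 3 + m" and m: "m \<ge> 0" by (intro that[of "k - 3"]) auto
    have "15*24625*((2*(3+m)+1)^4
        - (2*(3+m)+1)^2)*(2*(3+m)^2+4*(3+m)+(1))^2
        - 2*494^2*(2*(3+m)+1)^6
        - 2500*45*2*(2*(3+m)^2+4*(3+m)+(1))^4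
      = 569674562272 + 1298489949252*m + 1285296375180*m^2 + 721689018640*m^3
        + 251414633280*m^4 + 55637321232*m^5 + 7635953392*m^6 + 594000000*m^7 + 20040000*m^8"
      (is "?l = ?r") by Groebner_Basis.algebra
    moreover have "?r \<ge> 0" using m by simp
    ultimately have "?l \<ge> 0" by (simp only:)
    then show ?thesis by (simp add: P_def c k)
  qed
  then show ?thesis
    using sin_multiple_le[OF P d] k3 by (simp add: algebra_simps)
qed

text \<open>The same expansion for \<open>sin_cos_multiple_le\<close> with q = 2k+2 and d = 9 -
  2c.\<close>

lemma sin_cos_even_multiple_le:
  fixes k c :: real
  assumes "c = -1 \<and> k \<ge> 7 \<or> c = 1 \<and> k \<ge> 3 \<or> c = 3 \<and> k \<ge> 3"
  defines "P \<equiv> 2 * k^2 + 6 * k + c"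
  shows "(sin ((2 * k + 2) * (pi / P)))^2 * (cos (pi / P))^2
    \<le> ((2 * k + 2)^2 + 2 * c - 9) * (sin (pi / P))^2"
proof -
  have k3: "k \<ge> 3" using assms by auto
  then have "k^2 \<ge> 3^2" by (intro power_mono) auto
  then have P: "P \<ge> 4" using assms k3 by (auto simp: P_def)
  have "(2 * k + 2)^2 \<ge> 8^2" using k3 by (intro power_mono) auto
  then have d: "0 \<le> 9 - 2 * c" "9 - 2 * c \<le> (2 * k + 2)^2" using assms(1) by auto
  have "0 \<le> 15 * 24625 * ((2 * k + 2)^4 + 2 * (2 * k + 2)^2) * P^2
      - 494^2 * (15 * (2 * k + 2)^2 + 15 * (2 * k + 2)^4 + 2 * (2 * k + 2)^6)
      - 2500 * 45 * (9 - 2 * c) * P^4"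
    using assms(1)
  proof (elim disjE conjE)
    assume c: "c = -1" and "k \<ge> 7"
    then obtain m where k: "k = 7 + m" and m: "m \<ge> 0" by (intro that[of "k - 7"]) auto
    have "15*24625*((2*(7+m)+2)^4 + 2*(2*(7+m)+2)^2)*(2*(7+m)^2+6*(7+m)+(-1))^2
        - 494^2*(15*(2*(7+m)+2)^2 + 15*(2*(7+m)+2)^4 + 2*(2*(7+m)+2)^6)
        - 2500*45*11*(2*(7+m)^2+6*(7+m)+(-1))^4
      = 975028227268 + 7112999545056*m + 6155341879560*m^2 + 2377829797600*m^3
        + 512296057680*m^4 + 65950962816*m^5 + 5058983392*m^6 + 213840000*m^7 + 3840000*m^8"
      (is "?l = ?r") by Groebner_Basis.algebra
    moreover have "?r \<ge> 0" using m by simp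
    ultimately have "?l \<ge> 0" by (simp only:)
    then show ?thesis by (simp add: P_def c k)
  next
    assume c: "c = 1" and "k \<ge> 3"
    then obtain m where k: "k = 3 + m" and m: "m \<ge> 0" by (intro that[of "k - 3"]) auto
    have "15*24625*((2*(3+m)+2)^4 + 2*(2*(3+m)+2)^2)*(2*(3+m)^2+6*(3+m)+(1))^2
        - 494^2*(15*(2*(3+m)+2)^2 + 15*(2*(3+m)+2)^4 + 2*(2*(3+m)+2)^6)
        - 2500*45*7*(2*(3+m)^2+6*(3+m)+(1))^4
      = 516893779732 + 1102791551328*m + 1023443908680*m^2 + 540351343520*m^3
        + 177438295440*m^4 + 37047441408*m^5 + 4791863392*m^6 + 350160000*m^7 + 11040000*m^8"
      (is "?l = ?r") by Groebner_Basis.algebra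
    moreover have "?r \<ge> 0" using m by simp
    ultimately have "?l \<ge> 0" by (simp only:)
    then show ?thesis by (simp add: P_def c k)
  next
    assume c: "c = 3" and "k \<ge> 3"
    then obtain m where k: "k = 3 + m" and m: "m \<ge> 0" by (intro that[of "k - 3"]) auto
    have "15*24625*((2*(3+m)+2)^4 + 2*(2*(3+m)+2)^2)*(2*(3+m)^2+6*(3+m)+(3))^2
        - 494^2*(15*(2*(3+m)+2)^2 + 15*(2*(3+m)+2)^4 + 2*(2*(3+m)+2)^6)
        - 2500*45*3*(2*(3+m)^2+6*(3+m)+(3))^4
      = 1449165709732 + 2879265431328*m + 2490075508680*m^2 + 1224716743520*m^3
        + 374722255440*m^4 + 73027041408*m^5 + 8849543392*m^6 + 609360000*m^7 + 18240000*m^8"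
      (is "?l = ?r") by Groebner_Basis.algebra
    moreover have "?r \<ge> 0" using m by simp
    ultimately have "?l \<ge> 0" by (simp only:)
    then show ?thesis by (simp add: P_def c k)
  qed
  then show ?thesis
    using sin_cos_multiple_le[OF P d] k3 by (simp add: algebra_simps)
qed

text \<open>The worst case is c = -5. Lowering c further by d shrinks P by d but raises 4 - 2c by
  2d, which outweighs the loss because P >= 16k >= 112 and d <= k. At c = -5 the substitution k = 7
  + m again gives positive coefficients.\<close>

lemma less_sin_odd_multiple:
  fixes k c :: real
  assumes k: "k \<ge> 7" and c: "c \<le> -5" "9 - 8 * k \<le> 8 * c"
  defines "P \<equiv> 2 * k^2 + 4 * k + c"
  shows "((2 * k + 1)^2 + 2 * c - 4) * (sin (pi / P))^2 < (sin ((2 * k + 1) * (pi / P)))^2"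
proof -
  obtain m where m: "k = 7 + m" "m \<ge> 0" using k by (intro that[of "k - 7"]) auto
  define d where "d = -5 - c"
  have d: "d \<ge> 0" "d \<le> k" "c = -5 - d" using c k by (auto simp: d_def)
  define Q where "Q = 2 * k^2 + 4 * k - 5"
  have PQ: "P = Q - d" by (simp add: P_def Q_def d_def)
  have k2: "k^2 \<ge> 7 * k" using k by (simp add: power2_eq_square)
  have P16: "P \<ge> 16 * k" using d k k2 by (simp add: PQ Q_def)
  have "150 * 14 * Q^2 - 494 * (2 * k + 1)^4
      = 5737350 + 2924400*m + 499200*m^2 + 31680*m^3 + 496*m^4"
    unfolding Q_def m by Groebner_Basis.algebra
  moreover have "\<dots> > 0" using m by (intro add_pos_nonneg) auto
  ultimately have "494 * (2 * k + 1)^4 < 150 * 14 * Q^2" by linarith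
  also have "\<dots> \<le> 150 * (4 - 2 * c) * P^2"
  proof -
    have "(14 + 2 * d) * P^2 - 14 * Q^2 = d * (2 * P^2 - 28 * P - 14 * d)"
      by (simp add: PQ power2_eq_square algebra_simps)
    moreover have "P * P \<ge> 112 * P" using P16 k by (intro mult_right_mono) auto
    ultimately have "(14 + 2 * d) * P^2 \<ge> 14 * Q^2"
      using P16 d k by (smt (verit) mult_nonneg_nonneg power2_eq_square)
    then show ?thesis by (simp add: d(3) algebra_simps)
  qed
  finally have "494 * (2 * k + 1)^4 < 150 * (4 - 2 * c) * P^2" .
  then show ?thesis using less_sin_multiple[of P "2 * k + 1" "4 - 2 * c"] P16 k by (simp add: algebra_simps)
qed

text \<open>As before, with worst case c = -3, where 9 - 2c = 15.\<close>

lemma less_sin_cos_even_multiple: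
  fixes k c :: real
  assumes k: "k \<ge> 7" and c: "c \<le> -3" "25 - 8 * k \<le> 8 * c"
  defines "P \<equiv> 2 * k^2 + 6 * k + c"
  shows "((2 * k + 2)^2 + 2 * c - 9) * (sin (pi / P))^2
    < (sin ((2 * k + 2) * (pi / P)))^2 * (cos (pi / P))^2"
proof -
  obtain m where m: "k = 7 + m" "m \<ge> 0" using k by (intro that[of "k - 7"]) auto
  define d where "d = -3 - c"
  have d: "d \<ge> 0" "d \<le> k" "c = -3 - d" using c k by (auto simp: d_def)
  define Q where "Q = 2 * k^2 + 6 * k - 3"
  have PQ: "P = Q - d" by (simp add: P_def Q_def d_def)
  have k2: "k^2 \<ge> 7 * k" using k by (simp add: power2_eq_square)
  have P16: "P \<ge> 16 * k" using d k k2 by (simp add: PQ Q_def)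
  have "150 * 15 * Q^2 - 494 * ((2 * k + 2)^4 + 3 * (2 * k + 2)^2)
      = 9476074 + 4678760*m + 792936*m^2 + 53072*m^3 + 1096*m^4"
    unfolding Q_def m by Groebner_Basis.algebra
  moreover have "\<dots> > 0" using m by (intro add_pos_nonneg) auto
  ultimately have "494 * ((2 * k + 2)^4 + 3 * (2 * k + 2)^2) < 150 * 15 * Q^2" by linarith
  also have "\<dots> \<le> 150 * (9 - 2 * c) * P^2"
  proof -
    have "(15 + 2 * d) * P^2 - 15 * Q^2 = d * (2 * P^2 - 30 * P - 15 * d)"
      by (simp add: PQ power2_eq_square algebra_simps)
    moreover have "P * P \<ge> 112 * P" using P16 k by (intro mult_right_mono) auto
    ultimately have "(15 + 2 * d) * P^2 \<ge> 15 * Q^2"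
      using P16 d k by (smt (verit) mult_nonneg_nonneg power2_eq_square)
    then show ?thesis by (simp add: d(3) algebra_simps)
  qed
  finally have "494 * ((2 * k + 2)^4 + 3 * (2 * k + 2)^2) < 150 * (9 - 2 * c) * P^2" .
  then show ?thesis
    using less_sin_cos_multiple[of P "2 * k + 2" "9 - 2 * c"] P16 k by (simp add: algebra_simps)
qed

section \<open>Sums of roots of unity\<close>

lemma integral_over_period:
  fixes g :: "real \<Rightarrow> real"
  assumes cont: "continuous_on UNIV g" and per: "\<And>t. g (t + T) = g t" and "T > 0"
  shows "integral {s..s + T} g = integral {a..a + T} g"
proof -
  have intg: "g integrable_on {u..v}" for u v
    by (rule integrable_continuous_real) (rule continuous_on_subset[OF cont], simp)
  have shift: "integral {u + T..v + T} g = integral {u..v} g" for u v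
    using integral_shift_real_ivl[of "u + T" T "v + T" g] by (simp add: per)
  have shift_nat: "integral {u + real n * T..v + real n * T} g = integral {u..v} g" for u v n
  proof (induction n)
    case (Suc n)
    then show ?case using shift[of "u + real n * T" "v + real n * T"] by (simp add: algebra_simps)
  qed simp
  have shift_int: "integral {u + of_int n * T..v + of_int n * T} g = integral {u..v} g" for u v n
  proof (cases "n \<ge> 0")
    case True
    then show ?thesis using shift_nat[of u "nat n" v] by simp
  next
    case False
    then show ?thesis
      using shift_nat[of "u + of_int n * T" "nat (- n)" "v + of_int n * T"] by simp
  qed
  \<comment> \<open>Translating by \<open>n\<close> periods moves the left end into [a, a+T]; the
    piece beyond a+T is then moved back to the front.\<close>
  define n where "n = \<lfloor>(s - a) / T\<rfloor>"
  define s' where "s' = s - of_int n * T"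
  have "of_int n \<le> (s - a) / T" "(s - a) / T < of_int n + 1" unfolding n_def by linarith+
  then have s': "a \<le> s'" "s' \<le> a + T" using \<open>T > 0\<close> by (auto simp: s'_def field_simps)
  have "integral {s..s + T} g = integral {s'..s' + T} g"
    using shift_int[of s' n "s' + T"] by (simp add: s'_def algebra_simps)
  also have "\<dots> = integral {s'..a + T} g + integral {a + T..s' + T} g"
    using s' \<open>T > 0\<close> intg by (intro Henstock_Kurzweil_Integration.integral_combine[symmetric]) auto
  also have "integral {a + T..s' + T} g = integral {a..s'} g" by (rule shift)
  also have "integral {s'..a + T} g + integral {a..s'} g = integral {a..a + T} g"
    using Henstock_Kurzweil_Integration.integral_combine[OF s' intg] by simp
  finally show ?thesis .
qed

lemma integral_cos_minus_const:
  assumes "a \<le> (b::real)"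
  shows "((\<lambda>t. cos t - \<tau>) has_integral (sin b - sin a - (b - a) * \<tau>)) {a..b}"
proof -
  have "((\<lambda>t. cos t - \<tau>) has_integral ((sin b - b * \<tau>) - (sin a - a * \<tau>))) {a..b}"
    using assms
    by (intro fundamental_theorem_of_calculus)
       (auto intro!: derivative_eq_intros simp flip: has_real_derivative_iff_has_vector_derivative)
  then show ?thesis by (simp add: algebra_simps)
qed

text \<open>The part of the cosine above the level cos(alpha) is supported on
  [-alpha, alpha].\<close>

lemma integral_cos_truncated:
  assumes "0 \<le> \<alpha>" "\<alpha> \<le> pi"
  shows "integral {-pi..pi} (\<lambda>t. max 0 (cos t - cos \<alpha>)) = 2 * sin \<alpha> - 2 * \<alpha> * cos \<alpha>"
proof -
  let ?g = "\<lambda>t. max 0 (cos t - cos \<alpha>)"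
  have out: "(?g has_integral 0) {u..v}" if "\<And>t. t \<in> {u..v} \<Longrightarrow> cos t \<le> cos \<alpha>" for u v
    using that by (intro has_integral_is_0) auto
  have "(?g has_integral 0) {-pi..-\<alpha>}"
  proof (rule out)
    fix t assume "t \<in> {-pi..-\<alpha>}"
    then show "cos t \<le> cos \<alpha>" using assms cos_monotone_0_pi_le[of \<alpha> "- t"] by simp
  qed
  moreover have "(?g has_integral (sin \<alpha> - sin (-\<alpha>) - (\<alpha> - - \<alpha>) * cos \<alpha>)) {-\<alpha>..\<alpha>}"
  proof (rule has_integral_eq[OF _ integral_cos_minus_const])
    fix t assume "t \<in> {-\<alpha>..\<alpha>}"
    then have "cos \<alpha> \<le> cos \<bar>t\<bar>" using assms by (intro cos_monotone_0_pi_le) auto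
    then show "cos t - cos \<alpha> = ?g t" by simp
  qed (use assms in auto)
  moreover have "(?g has_integral 0) {\<alpha>..pi}"
    using assms by (intro out) (auto intro!: cos_monotone_0_pi_le)
  ultimately have "(?g has_integral (0 + (sin \<alpha> - sin (-\<alpha>) - (\<alpha> - - \<alpha>) * cos \<alpha>) + 0)) {-pi..pi}"
    using assms by (intro has_integral_combine[of "-pi" \<alpha> pi] has_integral_combine[of "-pi" "-\<alpha>" \<alpha>]) auto
  then show ?thesis by (auto simp: algebra_simps dest: integral_unique)
qed

text \<open>Replacing each point of the set by an arc of length \<open>2\<pi>/p\<close> turns the sum into an integral of
  the cosine over a subset of the circle of measure \<open>2\<pi>b/p\<close>; the integral is largest when that
  subset is an arc centred at the maximum of the cosine.\<close>

lemma sum_cos_le: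
  fixes B :: "nat set" and p :: nat and \<theta> :: real
  assumes B: "B \<subseteq> {..<p}" and p: "p \<ge> 2"
  shows "(\<Sum>b\<in>B. cos (2 * pi * real b / real p - \<theta>)) \<le> sin (pi * real (card B) / real p) / sin (pi / real p)"
proof -
  define x where "x = pi / real p"
  define \<alpha> where "\<alpha> = x * real (card B)"
  \<comment> \<open>Bathtub principle: after subtracting the level cos(alpha) and truncating at 0,
    all p arcs may be included at no loss. The subtracted levels over \<open>B\<close> add up to 2
    alpha cos(alpha), which cancels against the integral of \<open>g\<close>.\<close>
  define g where "g = (\<lambda>t. max 0 (cos t - cos \<alpha>))"
  define c where "c = (\<lambda>b. 2 * x * real b - \<theta>)"
  have x: "0 < x" "x < pi" using p by (auto simp: x_def field_simps)
  have sx: "sin x > 0" using x by (intro sin_gt_zero) auto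
  have fB: "finite B" using B finite_subset by blast
  have "card B \<le> p" using card_mono[OF _ B] by simp
  then have \<alpha>: "0 \<le> \<alpha>" "\<alpha> \<le> pi" using p by (auto simp: \<alpha>_def x_def field_simps)
  have cont: "continuous_on S g" for S unfolding g_def by (intro continuous_intros)
  have intg: "g integrable_on {u..v}" for u v by (intro integrable_continuous_real cont)
  have arc: "2 * sin x * cos (c b) - 2 * x * cos \<alpha> \<le> integral {c b - x..c b + x} g" for b
  proof -
    have "((\<lambda>t. cos t - cos \<alpha>) has_integral (sin (c b + x) - sin (c b - x) - (c b + x - (c b - x)) * cos \<alpha>)) {c b - x..c b + x}"
      using x by (intro integral_cos_minus_const) auto
    then have "sin (c b + x) - sin (c b - x) - (c b + x - (c b - x)) * cos \<alpha> \<le> integral {c b - x..c b + x} g"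
      by (rule has_integral_le[OF _ integrable_integral[OF intg]]) (auto simp: g_def)
    then show ?thesis by (simp add: sin_add sin_diff algebra_simps)
  qed
  \<comment> \<open>Consecutive arcs share an endpoint, so all p of them cover exactly one
    period.\<close>
  have all: "(\<Sum>b<n. integral {c b - x..c b + x} g) = integral {c 0 - x..c 0 - x + 2 * x * real n} g" for n
  proof (induction n)
    case (Suc n)
    have "integral {c 0 - x..c 0 - x + 2 * x * real n} g + integral {c n - x..c n + x} g
      = integral {c 0 - x..c 0 - x + 2 * x * real (Suc n)} g"
      using Henstock_Kurzweil_Integration.integral_combine[of "c 0 - x" "c n - x" "c n + x" g] x intg
      by (simp add: c_def algebra_simps)
    with Suc show ?case by simp
  qed simp
  have "(\<Sum>b\<in>B. 2 * sin x * cos (c b) - 2 * x * cos \<alpha>) \<le> (\<Sum>b\<in>B. integral {c b - x..c b + x} g)"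
    by (intro sum_mono arc)
  also have "\<dots> \<le> (\<Sum>b<p. integral {c b - x..c b + x} g)"
    using B by (intro sum_mono2 integral_nonneg intg) (auto simp: g_def)
  also have "\<dots> = integral {c 0 - x..c 0 - x + 2 * pi} g"
    using all[of p] p by (simp add: x_def)
  also have "\<dots> = integral {-pi..-pi + 2 * pi} g"
    by (rule integral_over_period[OF cont]) (auto simp: g_def)
  also have "\<dots> = 2 * sin \<alpha> - 2 * \<alpha> * cos \<alpha>"
    using integral_cos_truncated[OF \<alpha>] by (simp add: g_def)
  finally have "2 * sin x * (\<Sum>b\<in>B. cos (c b)) \<le> 2 * sin \<alpha>"
    using fB by (simp add: sum_subtractf sum_distrib_left \<alpha>_def algebra_simps)
  then have "(\<Sum>b\<in>B. cos (c b)) \<le> sin \<alpha> / sin x" using sx by (simp add: field_simps)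
  then show ?thesis by (simp add: c_def \<alpha>_def x_def mult_ac)
qed

section \<open>Roots of unity and their sums\<close>

definition unity_root :: "nat \<Rightarrow> int \<Rightarrow> complex" where
  "unity_root p i = cis (2 * pi * of_int i / real p)"

lemma unity_root_add: "unity_root p (i + j) = unity_root p i * unity_root p j"
  by (simp add: unity_root_def cis_mult ring_distribs add_divide_distrib)

lemma unity_root_0 [simp]: "unity_root p 0 = 1"
  by (simp add: unity_root_def)

lemma norm_unity_root [simp]: "norm (unity_root p i) = 1"
  by (simp add: unity_root_def)

lemma unity_root_minus: "unity_root p (- i) = cnj (unity_root p i)"
  by (simp add: unity_root_def cis_cnj)

lemma unity_root_period: "p > 0 \<Longrightarrow> unity_root p (int p * j) = 1"
  using cis_multiple_2pi[of "of_int j"] by (simp add: unity_root_def mult_ac)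

lemma unity_root_mod:
  assumes "p > 0" shows "unity_root p (i mod int p) = unity_root p i"
proof -
  have "unity_root p i = unity_root p (i mod int p + int p * (i div int p))" by simp
  then show ?thesis using assms by (simp only: unity_root_add unity_root_period mult_1_right)
qed

lemma unity_root_cong:
  assumes "p > 0" "i mod int p = j mod int p" shows "unity_root p i = unity_root p j"
  using assms unity_root_mod by metis

lemma unity_root_eq_1_iff:
  assumes "p > 0" shows "unity_root p i = 1 \<longleftrightarrow> int p dvd i"
proof
  assume "unity_root p i = 1"
  then have "cos (2 * pi * of_int i / real p) = 1" by (simp add: unity_root_def complex_eq_iff)
  then obtain n where "2 * pi * of_int i / real p = of_int n * 2 * pi"
    by (auto simp: cos_one_2pi_int)
  then have "real_of_int i = real_of_int (n * int p)" using assms by (simp add: field_simps)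
  then show "int p dvd i" by (metis dvd_triv_right of_int_eq_iff)
next
  assume "int p dvd i"
  then show "unity_root p i = 1" using assms unity_root_period by auto
qed

lemma inj_on_mult_mod:
  fixes j p :: int
  assumes "coprime j p" shows "inj_on (\<lambda>i. (j * i) mod p) {0..<p}"
proof (rule inj_onI)
  fix x y assume xy: "x \<in> {0..<p}" "y \<in> {0..<p}" "(j * x) mod p = (j * y) mod p"
  then have "p dvd j * (x - y)" by (simp add: mod_eq_dvd_iff right_diff_distrib)
  then have "p dvd x - y" using assms by (simp add: coprime_commute coprime_dvd_mult_right_iff)
  then have "x mod p = y mod p" by (simp add: mod_eq_dvd_iff)
  then show "x = y" using xy by simp
qed

text \<open>Shifting the summation index by 1 multiplies the sum by the j-th power of the root,
  which is not 1.\<close>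

lemma sum_unity_root:
  assumes "p > 0" and j: "\<not> int p dvd j"
  shows "(\<Sum>i\<in>{0..<int p}. unity_root p (j * i)) = 0"
proof -
  define f where "f = (\<lambda>i. unity_root p (j * i))"
  have "bij_betw (\<lambda>i. (i + 1) mod int p) {0..<int p} {0..<int p}"
  proof (rule bij_betw_byWitness[where f' = "\<lambda>i. (i - 1) mod int p"])
  qed (use assms in \<open>auto simp: mod_simps\<close>)
  then have "sum f {0..<int p} = (\<Sum>i\<in>{0..<int p}. f ((i + 1) mod int p))"
    by (rule sum.reindex_bij_betw[symmetric])
  also have "\<dots> = (\<Sum>i\<in>{0..<int p}. unity_root p j * f i)"
  proof (rule sum.cong[OF refl])
    fix i
    have "f ((i + 1) mod int p) = unity_root p (j + j * i)"
      unfolding f_def using assms by (intro unity_root_cong) (auto simp: mod_simps algebra_simps)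
    then show "f ((i + 1) mod int p) = unity_root p j * f i" by (simp add: f_def unity_root_add)
  qed
  finally have "sum f {0..<int p} = unity_root p j * sum f {0..<int p}"
    unfolding sum_distrib_left .
  then have "sum f {0..<int p} * (1 - unity_root p j) = 0" by (simp add: algebra_simps)
  then show ?thesis using unity_root_eq_1_iff[of p j] assms by (auto simp: f_def)
qed

text \<open>Multiplication by j is injective modulo p, so \<open>B\<close> may be replaced by a set
  of residues of the same size. Rotating by the argument of the sum turns its norm into a sum of
  cosines for \<open>sum_cos_le\<close>.\<close>

lemma norm_sum_unity_root_le:
  assumes "p \<ge> 2" and B: "B \<subseteq> {0..<int p}" and j: "coprime j (int p)"
  shows "norm (\<Sum>i\<in>B. unity_root p (j * i)) \<le> sin (pi * real (card B) / real p) / sin (pi / real p)"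
proof -
  define C where "C = (\<lambda>i. nat ((j * i) mod int p)) ` B"
  have inj: "inj_on (\<lambda>i. nat ((j * i) mod int p)) B"
  proof (rule inj_onI)
    fix x y assume "x \<in> B" "y \<in> B" "nat ((j * x) mod int p) = nat ((j * y) mod int p)"
    then show "x = y"
      using inj_onD[OF inj_on_mult_mod[OF j], of x y] subsetD[OF B, of x] subsetD[OF B, of y] assms(1)
      by (simp add: eq_nat_nat_iff)
  qed
  have C: "C \<subseteq> {..<p}" "card C = card B"
    using assms(1) inj by (auto simp: C_def card_image nat_less_iff)
  define z where "z = (\<Sum>i\<in>B. unity_root p (j * i))"
  define \<theta> where "\<theta> = Arg z"
  have z: "z = (\<Sum>b\<in>C. cis (2 * pi * real b / real p))"
    unfolding C_def sum.reindex[OF inj] z_def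
  proof (rule sum.cong[OF refl])
    fix i
    have "unity_root p (j * i) = unity_root p ((j * i) mod int p)"
      using assms(1) by (simp add: unity_root_mod)
    then show "unity_root p (j * i) = ((\<lambda>b. cis (2 * pi * real b / real p)) \<circ> (\<lambda>i. nat ((j * i) mod int p))) i"
      using assms(1) by (simp add: unity_root_def)
  qed
  have "of_real (norm z) = z * cis (- \<theta>)"
    using rcis_cmod_Arg[of z] unfolding \<theta>_def
    by (metis cis_mult cis_zero add.right_inverse mult.assoc mult.right_neutral rcis_def)
  also have "\<dots> = (\<Sum>b\<in>C. cis (2 * pi * real b / real p - \<theta>))"
    by (simp add: z sum_distrib_right cis_mult)
  finally have "norm z = Re (\<Sum>b\<in>C. cis (2 * pi * real b / real p - \<theta>))"
    by (metis Re_complex_of_real)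
  then have "norm z = (\<Sum>b\<in>C. cos (2 * pi * real b / real p - \<theta>))" by simp
  also have "\<dots> \<le> sin (pi * real (card B) / real p) / sin (pi / real p)"
    using sum_cos_le[OF C(1) assms(1)] C(2) by simp
  finally show ?thesis by (simp add: z_def)
qed

text \<open>The Dirichlet kernel: after multiplication by sin(pi/p) the sum telescopes. Centred
  intervals thus attain the previous bound.\<close>

lemma sum_unity_root_symmetric:
  assumes "p \<ge> 2"
  shows "(\<Sum>i\<in>{- int h..int h}. unity_root p i) = of_real (sin (pi * (2 * real h + 1) / real p) / sin (pi / real p))"
proof -
  have sx: "sin (pi / real p) > 0" using assms by (intro sin_gt_zero) (auto simp: field_simps)
  have "(\<Sum>i\<in>{- int h..int h}. unity_root p i) * of_real (sin (pi / real p))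
     = of_real (sin (pi * (2 * real h + 1) / real p))"
  proof (induction h)
    case (Suc h)
    have "{- int (Suc h)..int (Suc h)} = insert (- int (Suc h)) (insert (int (Suc h)) {- int h..int h})"
      by auto
    then have "(\<Sum>i\<in>{- int (Suc h)..int (Suc h)}. unity_root p i)
      = unity_root p (- int (Suc h)) + unity_root p (int (Suc h)) + (\<Sum>i\<in>{- int h..int h}. unity_root p i)"
      by simp
    also have "unity_root p (- int (Suc h)) + unity_root p (int (Suc h))
      = of_real (2 * cos (2 * pi * (real h + 1) / real p))"
      by (simp only: unity_root_minus) (simp add: unity_root_def complex_eq_iff algebra_simps)
    also have "(of_real (2 * cos (2 * pi * (real h + 1) / real p)) + (\<Sum>i\<in>{- int h..int h}. unity_root p i)) * of_real (sin (pi / real p))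
      = of_real (2 * cos (2 * pi * (real h + 1) / real p) * sin (pi / real p) + sin (pi * (2 * real h + 1) / real p))"
      using Suc by (simp add: ring_distribs)
    also have "2 * cos (2 * pi * (real h + 1) / real p) * sin (pi / real p) + sin (pi * (2 * real h + 1) / real p)
       = sin (pi * (2 * real (Suc h) + 1) / real p)"
    proof -
      define u v where "u = 2 * pi * (real h + 1) / real p" and "v = pi / real p"
      have "pi * (2 * real h + 1) / real p = u - v" "pi * (2 * real (Suc h) + 1) / real p = u + v"
        by (auto simp: u_def v_def algebra_simps add_divide_distrib)
      then show ?thesis by (simp add: sin_add sin_diff flip: u_def v_def)
    qed
    finally show ?case .
  qed simp
  then show ?thesis using sx by (simp add: field_simps)
qed

section \<open>Cayley graphs\<close>

lemma cayley_graph_simps [simp]: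
  "pverts (cayley_graph G S) = carrier G"
  "parcs (cayley_graph G S) = {(g, h). g \<in> carrier G \<and> h \<in> carrier G \<and> inv\<^bsub>G\<^esub> g \<otimes>\<^bsub>G\<^esub> h \<in> S}"
  by (simp_all add: cayley_graph_def)

lemma adj_eigenvalue_iff:
  assumes "finite (pverts X)"
  shows "adj_eigenvalue X l \<longleftrightarrow>
    (\<exists>f. (\<exists>v\<in>pverts X. f v \<noteq> 0) \<and>
         (\<forall>v\<in>pverts X. (\<Sum>w\<in>pverts X. of_bool ((v, w) \<in> parcs X) * f w) = l * f v))"
proof -
  obtain vs where "set vs = pverts X" "distinct vs"
    using finite_distinct_list[OF assms] by blast
  then show ?thesis
    unfolding adj_eigenvalue_def using eigenvalue_adj_matrix_iff[of _ X l] by meson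
qed

text \<open>Finiteness gives the \<open>Max\<close> in \<open>graph_mu\<close> its meaning; the
  eigenvalues are roots of a single characteristic polynomial.\<close>

lemma finite_adj_eigenvalues:
  assumes "finite (pverts X)" "pverts X \<noteq> {}"
  shows "finite {l. adj_eigenvalue X l}"
proof -
  obtain vs where vs: "set vs = pverts X" "distinct vs"
    using finite_distinct_list[OF assms(1)] by blast
  let ?A = "adj_matrix X vs"
  have A: "?A \<in> carrier_mat (length vs) (length vs)" by (simp add: adj_matrix_def)
  have "{l. adj_eigenvalue X l} \<subseteq> {l. poly (char_poly ?A) l = 0}"
    using vs unfolding adj_eigenvalue_def
    by (auto simp: eigenvalue_adj_matrix_iff eigenvalue_root_char_poly[OF A, symmetric])
  moreover have "char_poly ?A \<noteq> 0"
    using degree_monic_char_poly[OF A] by auto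
  ultimately show ?thesis using poly_roots_finite finite_subset by blast
qed

locale cayley = group G for G (structure) +
  fixes S
  assumes finite_carrier: "finite (carrier G)" and cayley_subset: "cayley_subset G S"
begin

abbreviation "X \<equiv> cayley_graph G S"

lemma S_carrier: "S \<subseteq> carrier G" and one_notin_S: "\<one> \<notin> S" and S_inv: "m_inv G ` S = S"
  and S_generates: "generate G S = carrier G"
  using cayley_subset by (auto simp: cayley_subset_def)

lemma finite_S: "finite S"
  using S_carrier finite_carrier finite_subset by blast

lemma neighbours:
  assumes "g \<in> carrier G"
  shows "{h \<in> carrier G. inv g \<otimes> h \<in> S} = (\<lambda>s. g \<otimes> s) ` S"
proof (intro Set.set_eqI iffI)
  fix h assume h: "h \<in> {h \<in> carrier G. inv g \<otimes> h \<in> S}"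
  then have "h = g \<otimes> (inv g \<otimes> h)" using assms by (simp flip: m_assoc)
  then show "h \<in> (\<lambda>s. g \<otimes> s) ` S" using h by blast
next
  fix h assume "h \<in> (\<lambda>s. g \<otimes> s) ` S"
  then show "h \<in> {h \<in> carrier G. inv g \<otimes> h \<in> S}"
    using assms S_carrier by (auto simp flip: m_assoc)
qed

lemma inj_translate: "g \<in> carrier G \<Longrightarrow> inj_on (\<lambda>s. g \<otimes> s) S"
  using S_carrier by (auto intro!: inj_onI simp: subset_eq)

lemma sum_neighbours:
  fixes f :: "'a \<Rightarrow> complex"
  assumes g: "g \<in> carrier G"
  shows "(\<Sum>w\<in>carrier G. of_bool ((g, w) \<in> parcs X) * f w) = (\<Sum>s\<in>S. f (g \<otimes> s))"
proof -
  have "(\<Sum>w\<in>carrier G. of_bool ((g, w) \<in> parcs X) * f w) = (\<Sum>w\<in>{h \<in> carrier G. inv g \<otimes> h \<in> S}. f w)"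
    using finite_carrier g by (intro sum.mono_neutral_cong_right) auto
  then show ?thesis unfolding neighbours[OF g] using sum.reindex[OF inj_translate[OF g], of f] by simp
qed

text \<open>On functions on the group, the adjacency operator is the sum of the right translations
  by elements of \<open>S\<close>.\<close>

lemma adj_eigenvalue_cayley_iff:
  "adj_eigenvalue X l \<longleftrightarrow>
    (\<exists>f. (\<exists>v\<in>carrier G. f v \<noteq> 0) \<and> (\<forall>v\<in>carrier G. (\<Sum>s\<in>S. f (v \<otimes> s)) = l * f v))"
  using finite_carrier sum_neighbours by (simp add: adj_eigenvalue_iff del: cayley_graph_simps(2))

lemma pair_graph_cayley: "pair_graph X"
proof
  show "finite (parcs X)"
    by (rule finite_subset[of _ "carrier G \<times> carrier G"]) (use finite_carrier in auto)
  show "fst e \<noteq> snd e" if "e \<in> parcs X" for e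
    using that one_notin_S by auto
  show "symmetric (with_proj X)"
  proof -
    have "inv h \<otimes> g \<in> S" if "g \<in> carrier G" "h \<in> carrier G" "inv g \<otimes> h \<in> S" for g h
    proof -
      have "inv (inv g \<otimes> h) \<in> S" using that S_inv by blast
      then show ?thesis using that by (simp add: inv_mult_group)
    qed
    then show ?thesis by (auto simp: symmetric_def sym_def)
  qed
qed (use finite_carrier in auto)

text \<open>A word in the generators is a walk; inverse letters are edges too, because
  \<open>S\<close> is closed under inversion.\<close>

lemma reachable_cayley:
  assumes "h \<in> generate G S" "g \<in> carrier G"
  shows "g \<rightarrow>\<^sup>*\<^bsub>with_proj X\<^esub> (g \<otimes> h)"
proof -
  interpret pair_graph X by (rule pair_graph_cayley)
  have step: "g \<rightarrow>\<^sup>*\<^bsub>with_proj X\<^esub> (g \<otimes> s)" if "s \<in> S" "g \<in> carrier G" for g s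
  proof -
    have "(g, g \<otimes> s) \<in> parcs X" using that S_carrier by (auto simp flip: m_assoc)
    then show ?thesis by (intro reachable_adjI) simp
  qed
  show ?thesis
    using assms
  proof (induction arbitrary: g rule: generate.induct)
    case one
    then show ?case by (simp add: reachable_refl)
  next
    case (incl h)
    then show ?case by (intro step)
  next
    case (inv h)
    then show ?case using S_inv by (intro step) auto
  next
    case (eng h1 h2)
    then have h: "h1 \<in> carrier G" "h2 \<in> carrier G" using S_generates by auto
    have "(g \<otimes> h1) \<rightarrow>\<^sup>*\<^bsub>with_proj X\<^esub> (g \<otimes> h1 \<otimes> h2)" using eng h by auto
    with eng.IH(1)[OF eng.prems] have "g \<rightarrow>\<^sup>*\<^bsub>with_proj X\<^esub> (g \<otimes> h1 \<otimes> h2)"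
      by (rule reachable_trans)
    then show ?case using h eng.prems by (simp add: m_assoc)
  qed
qed

lemma connected_cayley: "Digraph_Component.connected (with_proj X)"
proof -
  interpret pair_graph X by (rule pair_graph_cayley)
  have "strongly_connected (with_proj X)"
  proof
    show "verts (with_proj X) \<noteq> {}" by auto
  next
    fix u v assume "u \<in> verts (with_proj X)" "v \<in> verts (with_proj X)"
    then show "u \<rightarrow>\<^sup>*\<^bsub>with_proj X\<^esub> v"
      using reachable_cayley[of "inv u \<otimes> v" u] S_generates by (simp flip: m_assoc)
  qed
  then show ?thesis
    using pair_sym_arcs by (auto simp: connected_def strongly_connected_def reachable_mk_symmetric_eq)
qed

lemma regular_cayley: "regular_graph X k \<longleftrightarrow> k = card S"
proof -
  have "out_degree (with_proj X) g = card S" if g: "g \<in> carrier G" for g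
  proof -
    have "out_arcs (with_proj X) g = Pair g ` {h \<in> carrier G. inv g \<otimes> h \<in> S}"
      using g by (auto simp: out_arcs_def)
    then show ?thesis
      by (simp add: out_degree_def neighbours[OF g] card_image inj_on_def card_image[OF inj_translate[OF g]])
  qed
  then show ?thesis by (auto simp: regular_graph_def)
qed

lemma ramanujan_cayley_iff:
  assumes "S \<noteq> {}"
  shows "ramanujan X \<longleftrightarrow>
    (\<forall>l. adj_eigenvalue X l \<and> cmod l \<noteq> real (card S) \<longrightarrow> cmod l \<le> 2 * sqrt (real (card S) - 1))"
proof -
  have fin: "finite {cmod l |l. adj_eigenvalue X l \<and> cmod l \<noteq> real (card S)}"
  proof (rule finite_subset)
    show "finite (cmod ` {l. adj_eigenvalue X l})"
      using finite_carrier one_closed by (intro finite_imageI finite_adj_eigenvalues) auto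
  qed auto
  \<comment> \<open>The bound is thus nonnegative, so the 0 inserted in \<open>graph_mu\<close>
    imposes no condition.\<close>
  have "card S \<ge> 1" using assms finite_S by (simp add: Suc_le_eq card_gt_0_iff)
  then have "0 \<le> 2 * sqrt (real (card S) - 1)" by simp
  with fin have "graph_mu X (card S) \<le> 2 * sqrt (real (card S) - 1) \<longleftrightarrow>
    (\<forall>l. adj_eigenvalue X l \<and> cmod l \<noteq> real (card S) \<longrightarrow> cmod l \<le> 2 * sqrt (real (card S) - 1))"
    unfolding graph_mu_def by (subst Max_le_iff) auto
  then show ?thesis
    using pair_graph_cayley connected_cayley by (auto simp: ramanujan_def regular_cayley)
qed

end

section \<open>Spectra of dihedral Cayley graphs\<close>

lemma dihedral_simps:
  "carrier (dihedral p) = {0..<int p} \<times> UNIV"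
  "\<one>\<^bsub>dihedral p\<^esub> = (0, False)"
  "(i, False) \<otimes>\<^bsub>dihedral p\<^esub> (j, b) = ((i + j) mod int p, b)"
  "(i, True) \<otimes>\<^bsub>dihedral p\<^esub> (j, b) = ((i - j) mod int p, \<not> b)"
  by (simp_all add: dihedral_def)

lemma dihedral_inv:
  assumes "i \<in> {0..<int p}"
  shows "inv\<^bsub>dihedral p\<^esub> (i, False) = ((- i) mod int p, False)"
    and "inv\<^bsub>dihedral p\<^esub> (i, True) = (i, True)"
proof -
  interpret group "dihedral p" using assms by (intro group_dihedral) auto
  show "inv\<^bsub>dihedral p\<^esub> (i, False) = ((- i) mod int p, False)"
    using assms by (intro inv_equality) (auto simp: dihedral_simps mod_simps)
  show "inv\<^bsub>dihedral p\<^esub> (i, True) = (i, True)"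
    using assms by (intro inv_equality) (auto simp: dihedral_simps mod_simps)
qed

text \<open>At \<open>False\<close> and \<open>True\<close> these are the exponent sets A and B of
  the introduction.\<close>

definition missing :: "nat \<Rightarrow> (int \<times> bool) set \<Rightarrow> bool \<Rightarrow> int set" where
  "missing p S b = {i \<in> {0..<int p}. (i, b) \<notin> S}"

lemma finite_missing [simp]: "finite (missing p S b)"
  by (rule finite_subset[of _ "{0..<int p}"]) (auto simp: missing_def)

lemma missing_subset: "missing p S b \<subseteq> {0..<int p}"
  by (auto simp: missing_def)

lemma sum_not_missing:
  fixes F :: "int \<Rightarrow> 'a::ab_group_add"
  shows "sum F ({0..<int p} - missing p S b) = sum F {0..<int p} - sum F (missing p S b)"
  using missing_subset by (intro sum_diff) auto

lemma subset_dihedral_eq: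
  assumes "S \<subseteq> carrier (dihedral p)"
  shows "S = (\<lambda>i. (i, False)) ` ({0..<int p} - missing p S False)
    \<union> (\<lambda>i. (i, True)) ` ({0..<int p} - missing p S True)" (is "S = ?R")
proof (rule Set.set_eqI)
  fix s :: "int \<times> bool"
  obtain i b where "s = (i, b)" by fastforce
  then show "s \<in> S \<longleftrightarrow> s \<in> ?R" using assms by (cases b) (auto simp: missing_def dihedral_simps)
qed

lemma sum_dihedral_subset:
  fixes F :: "int \<times> bool \<Rightarrow> 'a::comm_monoid_add"
  assumes "S \<subseteq> carrier (dihedral p)"
  shows "sum F S = (\<Sum>i\<in>{0..<int p} - missing p S False. F (i, False))
    + (\<Sum>i\<in>{0..<int p} - missing p S True. F (i, True))"
  by (subst subset_dihedral_eq[OF assms], subst sum.union_disjoint)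
     (auto simp: sum.reindex inj_on_def o_def)

lemma card_missing:
  assumes "S \<subseteq> carrier (dihedral p)"
  shows "card S + card (missing p S False) + card (missing p S True) = 2 * p"
proof -
  have "card S = card ({0..<int p} - missing p S False) + card ({0..<int p} - missing p S True)"
    using sum_dihedral_subset[OF assms, of "\<lambda>_. 1::nat"] by simp
  moreover have "card ({0..<int p} - missing p S b) + card (missing p S b) = p" for b
    using card_Diff_subset[OF finite_missing missing_subset] card_mono[OF _ missing_subset, of p S b]
    by simp
  from this[of False] this[of True] calculation show ?thesis by linarith
qed

text \<open>Negation pairs the elements below p/2 with those above, and 0 is left alone because p is
  odd.\<close>

lemma odd_card_symmetric:
  assumes "odd p" and A: "A \<subseteq> {0..<int p}" "0 \<in> A" and sym: "\<And>i. i \<in> A \<Longrightarrow> (- i) mod int p \<in> A"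
  shows "odd (card A)"
proof -
  define L where "L = {i \<in> A. 0 < i \<and> 2 * i < int p}"
  define U where "U = {i \<in> A. int p < 2 * i}"
  have neg: "(- i) mod int p = int p - i" if "0 < i" "i < int p" for i
    using that by (simp add: zmod_zminus1_eq_if)
  have fin: "finite A" using A finite_subset by blast
  have "U = (\<lambda>i. int p - i) ` L"
  proof (intro Set.set_eqI iffI)
    fix i assume i: "i \<in> U"
    then have "0 < i" "i < int p" using A by (auto simp: U_def)
    then have "int p - i \<in> L" using i neg[of i] sym[of i] by (auto simp: L_def U_def)
    then show "i \<in> (\<lambda>i. int p - i) ` L" by (intro image_eqI[of _ _ "int p - i"]) auto
  next
    fix i assume "i \<in> (\<lambda>i. int p - i) ` L"
    then obtain k where k: "k \<in> L" "i = int p - k" by auto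
    then have "0 < k" "k < int p" using A by (auto simp: L_def)
    then show "i \<in> U" using k neg[of k] sym[of k] by (auto simp: L_def U_def)
  qed
  then have "card U = card L" by (simp add: card_image inj_on_def)
  moreover have "A = insert 0 (L \<union> U)"
  proof -
    have "2 * i \<noteq> int p" for i using \<open>odd p\<close> by presburger
    then have "i = 0 \<or> 0 < i \<and> 2 * i < int p \<or> int p < 2 * i" if "i \<in> A" for i
      using A that by (metis atLeastLessThan_iff linorder_neqE_linordered_idom not_less subsetD)
    then show ?thesis using A(2) by (auto simp: L_def U_def)
  qed
  moreover have "finite L" "finite U" "0 \<notin> L \<union> U" "L \<inter> U = {}"
    using fin by (auto simp: L_def U_def)
  ultimately show ?thesis by (simp add: card_Un_disjoint)
qed

context
  fixes p :: nat
  assumes p: "prime p" "p > 2"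
begin

lemma p_pos: "p > 0" and p_odd: "odd p"
  using p prime_odd_nat by auto

lemma cayley_dihedral: "cayley_subset (dihedral p) S \<Longrightarrow> cayley (dihedral p) S"
  using p_pos by (simp add: cayley_def cayley_axioms_def group_dihedral dihedral_simps)

lemma missing_cayley:
  assumes "cayley_subset (dihedral p) S"
  shows "0 \<in> missing p S False" "odd (card (missing p S False))"
    "card S + card (missing p S False) + card (missing p S True) = 2 * p"
proof -
  interpret cayley "dihedral p" S by (rule cayley_dihedral[OF assms])
  show 0: "0 \<in> missing p S False"
    using one_notin_S p_pos by (simp add: missing_def dihedral_simps)
  show "card S + card (missing p S False) + card (missing p S True) = 2 * p"
    by (rule card_missing[OF S_carrier])
  show "odd (card (missing p S False))"
  proof (rule odd_card_symmetric[OF p_odd missing_subset 0])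
    fix i assume i: "i \<in> missing p S False"
    show "(- i) mod int p \<in> missing p S False"
    proof (rule ccontr)
      assume "(- i) mod int p \<notin> missing p S False"
      then have "((- i) mod int p, False) \<in> S" using p_pos by (simp add: missing_def)
      then have "inv\<^bsub>dihedral p\<^esub> ((- i) mod int p, False) \<in> S" using S_inv by blast
      moreover have "inv\<^bsub>dihedral p\<^esub> ((- i) mod int p, False) = (i, False)"
        using i p_pos by (subst dihedral_inv) (auto simp: missing_def mod_simps)
      ultimately show False using i by (simp add: missing_def)
    qed
  qed
qed

lemma coprime_p: "j \<in> {0<..<int p} \<Longrightarrow> coprime j (int p)"
  using p by (metis coprime_commute greaterThanLessThan_iff prime_imp_coprime prime_int_nat_transfer
      zdvd_not_zless prime_nat_int_transfer)

section \<open>Fourier transform on the rotations and bounds for the eigenvalues\<close>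

lemma sum_shift_mod:
  fixes F :: "int \<Rightarrow> 'a::comm_monoid_add"
  shows "(\<Sum>i\<in>{0..<int p}. F ((i + a) mod int p)) = (\<Sum>i\<in>{0..<int p}. F i)"
proof (rule sum.reindex_bij_betw)
  show "bij_betw (\<lambda>i. (i + a) mod int p) {0..<int p} {0..<int p}"
    by (rule bij_betw_byWitness[where f' = "\<lambda>i. (i - a) mod int p"])
       (use p_pos in \<open>auto simp: mod_simps\<close>)
qed

text \<open>The minus sign makes translation by a act as multiplication by the root with exponent
  ja, matching the character sums over \<open>S\<close>.\<close>

definition fourier :: "(int \<Rightarrow> complex) \<Rightarrow> int \<Rightarrow> complex" where
  "fourier h j = (\<Sum>i\<in>{0..<int p}. unity_root p (- (j * i)) * h i)"

lemma fourier_shift: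
  "fourier (\<lambda>i. h ((i + a) mod int p)) j = unity_root p (j * a) * fourier h j"
proof -
  have "unity_root p (- (j * i)) * h ((i + a) mod int p)
    = unity_root p (j * a) * (unity_root p (- (j * ((i + a) mod int p))) * h ((i + a) mod int p))" for i
  proof -
    have "unity_root p (- j * ((i + a) mod int p)) = unity_root p (- j * (i + a))"
      using p_pos by (intro unity_root_cong mod_mult_right_eq)
    moreover have "unity_root p (- (j * i)) = unity_root p (j * a) * unity_root p (- j * (i + a))"
      by (simp add: algebra_simps flip: unity_root_add)
    ultimately show ?thesis by simp
  qed
  then have "fourier (\<lambda>i. h ((i + a) mod int p)) j
    = unity_root p (j * a) * (\<Sum>i\<in>{0..<int p}. unity_root p (- (j * ((i + a) mod int p))) * h ((i + a) mod int p))"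
    unfolding fourier_def sum_distrib_left by (rule sum.cong[OF refl])
  also have "\<dots> = unity_root p (j * a) * fourier h j"
    using sum_shift_mod[of "\<lambda>i. unity_root p (- (j * i)) * h i" a] by (simp add: fourier_def)
  finally show ?thesis .
qed

lemma fourier_inversion:
  assumes "m \<in> {0..<int p}"
  shows "(\<Sum>j\<in>{0..<int p}. unity_root p (j * m) * fourier h j) = of_nat p * h m"
proof -
  have "(\<Sum>j\<in>{0..<int p}. unity_root p (j * m) * fourier h j)
    = (\<Sum>j\<in>{0..<int p}. \<Sum>i\<in>{0..<int p}. unity_root p ((m - i) * j) * h i)"
    unfolding fourier_def sum_distrib_left
    by (intro sum.cong refl) (simp add: algebra_simps flip: unity_root_add mult.assoc)
  also have "\<dots> = (\<Sum>i\<in>{0..<int p}. (\<Sum>j\<in>{0..<int p}. unity_root p ((m - i) * j)) * h i)"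
    by (subst sum.swap) (simp add: sum_distrib_right)
  also have "\<dots> = (\<Sum>i\<in>{0..<int p}. if i = m then of_nat p * h m else 0)"
  proof (rule sum.cong[OF refl])
    fix i assume i: "i \<in> {0..<int p}"
    show "(\<Sum>j\<in>{0..<int p}. unity_root p ((m - i) * j)) * h i = (if i = m then of_nat p * h m else 0)"
    proof (cases "i = m")
      case False
      have "\<not> int p dvd m - i"
        using False i assms by (metis atLeastLessThan_iff mod_eq_dvd_iff mod_pos_pos_trivial)
      then show ?thesis using False sum_unity_root[OF p_pos] by simp
    qed simp
  qed
  also have "\<dots> = of_nat p * h m" using assms by simp
  finally show ?thesis .
qed

text \<open>A Gershgorin argument for a 2 by 2 system: use the equation belonging to the larger of
  the two components.\<close>

lemma norm_le_of_swap:
  fixes l a b a' b' F G :: complex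
  assumes "l * F = a * F + b * G" "l * G = a' * G + b' * F" "F \<noteq> 0 \<or> G \<noteq> 0"
    and "norm a \<le> u" "norm a' \<le> u" "norm b \<le> v" "norm b' \<le> v"
  shows "norm l \<le> u + v"
proof -
  have *: "norm l \<le> u + v"
    if "l * F = a * F + b * G" "norm G \<le> norm F" "F \<noteq> 0" "norm a \<le> u" "norm b \<le> v" for a b F G
  proof -
    have "norm l * norm F \<le> norm a * norm F + norm b * norm G"
      by (metis norm_mult norm_triangle_ineq that(1))
    also have "\<dots> \<le> u * norm F + v * norm F"
      using that by (intro add_mono mult_mono) (auto intro: order_trans[OF norm_ge_zero])
    finally have "norm l * norm F \<le> (u + v) * norm F" by (simp add: algebra_simps)
    then show ?thesis using that(3) by simp
  qed
  show ?thesis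
  proof (cases "norm G \<le> norm F")
    case True
    then have "F \<noteq> 0" using assms(3) by auto
    then show ?thesis using True * [of F a b G] assms by auto
  next
    case False
    then have "G \<noteq> 0" by auto
    then show ?thesis using False * [of G a' b' F] assms by auto
  qed
qed

text \<open>The Fourier transforms of an eigenfunction on the rotations and on the reflections
  satisfy, for each frequency j, a 2 by 2 system. By inversion one of them is nonzero at some j.
  Frequency 0 yields the first alternative, the others the second.\<close>

lemma adj_eigenvalue_dihedral_le:
  assumes S: "cayley_subset (dihedral p) S"
    and l: "adj_eigenvalue (cayley_graph (dihedral p) S) l" "cmod l \<noteq> real (card S)"
  shows "cmod l \<le> \<bar>real (card (missing p S True)) - real (card (missing p S False))\<bar> \<or>
    (\<exists>j\<in>{0<..<int p}. cmod l \<le> norm (\<Sum>i\<in>missing p S False. unity_root p (j * i))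
      + norm (\<Sum>i\<in>missing p S True. unity_root p (j * i)))"
proof -
  interpret cayley "dihedral p" S by (rule cayley_dihedral[OF S])
  define A B where "A = {0..<int p} - missing p S False" and "B = {0..<int p} - missing p S True"
  obtain f where f0: "\<exists>v\<in>carrier (dihedral p). f v \<noteq> 0"
    and f: "\<And>v. v \<in> carrier (dihedral p) \<Longrightarrow> (\<Sum>s\<in>S. f (v \<otimes>\<^bsub>dihedral p\<^esub> s)) = l * f v"
    using l(1) by (auto simp: adj_eigenvalue_cayley_iff)
  define F G where "F = fourier (\<lambda>i. f (i, False))" and "G = fourier (\<lambda>i. f (i, True))"
  define \<alpha> \<beta> where "\<alpha> j = (\<Sum>i\<in>A. unity_root p (j * i))" and "\<beta> j = (\<Sum>i\<in>B. unity_root p (j * i))" for j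
  have fourier_sum: "fourier (\<lambda>i. (\<Sum>a\<in>T. h ((i + a) mod int p)) + (\<Sum>b\<in>U. k ((i + b) mod int p))) j
    = (\<Sum>a\<in>T. unity_root p (j * a)) * fourier h j + (\<Sum>b\<in>U. unity_root p (j * b)) * fourier k j"
    if "finite T" "finite U" for T U h k j
  proof -
    have "fourier (\<lambda>i. (\<Sum>a\<in>T. h ((i + a) mod int p)) + (\<Sum>b\<in>U. k ((i + b) mod int p))) j
      = (\<Sum>a\<in>T. fourier (\<lambda>i. h ((i + a) mod int p)) j) + (\<Sum>b\<in>U. fourier (\<lambda>i. k ((i + b) mod int p)) j)"
      unfolding fourier_def distrib_left sum.distrib sum_distrib_left by (subst (1 2) sum.swap) (rule refl)
    then show ?thesis unfolding fourier_shift by (simp add: sum_distrib_right)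
  qed
  have fourier_cong: "fourier h j = fourier k j" if "\<And>i. i \<in> {0..<int p} \<Longrightarrow> h i = k i" for h k j
    unfolding fourier_def using that by (intro sum.cong) auto
  have fourier_scale: "fourier (\<lambda>i. c * h i) j = c * fourier h j" for c h j
    by (simp add: fourier_def sum_distrib_left mult_ac)
  have sumS: "(\<Sum>s\<in>S. H s) = (\<Sum>a\<in>A. H (a, False)) + (\<Sum>b\<in>B. H (b, True))" for H :: "_ \<Rightarrow> complex"
    unfolding A_def B_def by (rule sum_dihedral_subset[OF S_carrier])
  have finAB: "finite A" "finite B" by (auto simp: A_def B_def)
  have F: "l * F j = \<alpha> j * F j + \<beta> j * G j" for j
  proof -
    have "l * F j = fourier (\<lambda>i. (\<Sum>a\<in>A. f ((i + a) mod int p, False)) + (\<Sum>b\<in>B. f ((i + b) mod int p, True))) j"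
      unfolding F_def fourier_scale[symmetric]
    proof (rule fourier_cong)
      fix i assume "i \<in> {0..<int p}"
      then show "l * f (i, False) = (\<Sum>a\<in>A. f ((i + a) mod int p, False)) + (\<Sum>b\<in>B. f ((i + b) mod int p, True))"
        using f[of "(i, False)"] by (simp add: sumS dihedral_simps)
    qed
    then show ?thesis
      by (simp add: fourier_sum[OF finAB, of "\<lambda>i. f (i, False)" "\<lambda>i. f (i, True)"] F_def G_def \<alpha>_def \<beta>_def)
  qed
  \<comment> \<open>Right multiplication of a reflection by an element with exponent a shifts by -a,
    hence the conjugates.\<close>
  have G: "l * G j = cnj (\<alpha> j) * G j + cnj (\<beta> j) * F j" for j
  proof -
    have "l * G j = fourier (\<lambda>i. (\<Sum>a\<in>uminus ` A. f ((i + a) mod int p, True))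
        + (\<Sum>b\<in>uminus ` B. f ((i + b) mod int p, False))) j"
      unfolding G_def fourier_scale[symmetric]
    proof (rule fourier_cong)
      fix i assume "i \<in> {0..<int p}"
      then show "l * f (i, True) = (\<Sum>a\<in>uminus ` A. f ((i + a) mod int p, True))
        + (\<Sum>b\<in>uminus ` B. f ((i + b) mod int p, False))"
        using f[of "(i, True)"] by (simp add: sumS dihedral_simps sum.reindex)
    qed
    also have "\<dots> = (\<Sum>a\<in>uminus ` A. unity_root p (j * a)) * G j + (\<Sum>b\<in>uminus ` B. unity_root p (j * b)) * F j"
      unfolding F_def G_def
      by (rule fourier_sum[of _ _ "\<lambda>i. f (i, True)" "\<lambda>i. f (i, False)"]) (use finAB in auto)
    finally show ?thesis by (simp add: \<alpha>_def \<beta>_def sum.reindex unity_root_minus)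
  qed
  have "\<exists>j\<in>{0..<int p}. F j \<noteq> 0 \<or> G j \<noteq> 0"
  proof (rule ccontr)
    assume "\<not> ?thesis"
    then have *: "F j = 0" "G j = 0" if "j \<in> {0..<int p}" for j using that by auto
    have "f (i, False) = 0" "f (i, True) = 0" if "i \<in> {0..<int p}" for i
      using fourier_inversion[OF that, of "\<lambda>i. f (i, False)"] fourier_inversion[OF that, of "\<lambda>i. f (i, True)"] * p_pos
      unfolding F_def G_def by auto
    then show False using f0 by (auto simp: dihedral_simps) (metis (full_types))
  qed
  then obtain j where j: "j \<in> {0..<int p}" "F j \<noteq> 0 \<or> G j \<noteq> 0" by blast
  show ?thesis
  proof (cases "j = 0")
    case True
    have ab: "\<alpha> 0 = of_nat (card A)" "\<beta> 0 = of_nat (card B)" by (auto simp: \<alpha>_def \<beta>_def)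
    have cS: "card S = card A + card B"
      using sum_dihedral_subset[OF S_carrier, of "\<lambda>_. 1::nat"] by (simp add: A_def B_def)
    \<comment> \<open>At frequency 0 sum and difference decouple the system, with eigenvalues card S
      and b - a; the first is excluded by the assumption on \<open>l\<close>.\<close>
    have plus: "(l - of_nat (card S)) * (F 0 + G 0) = 0"
      using F[of 0] G[of 0] by (simp add: ab cS algebra_simps)
    have minus: "(l - (of_nat (card A) - of_nat (card B))) * (F 0 - G 0) = 0"
      using F[of 0] G[of 0] by (simp add: ab algebra_simps)
    have "l \<noteq> of_nat (card S)" using l(2) by auto
    with plus have "F 0 = - G 0" by (simp add: eq_neg_iff_add_eq_0)
    with minus j(2) True have "l = of_nat (card A) - of_nat (card B)" by auto
    moreover have "real (card {0..<int p}) = real (card A) + real (card (missing p S False))"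
      "real (card {0..<int p}) = real (card B) + real (card (missing p S True))"
      using card_Diff_subset[OF finite_missing missing_subset] card_mono[OF _ missing_subset]
      unfolding A_def B_def by (simp_all flip: of_nat_add)
    ultimately have "l = of_real (real (card (missing p S True)) - real (card (missing p S False)))"
      by (simp add: complex_eq_iff)
    then show ?thesis by (simp only: norm_of_real) simp
  next
    case False
    then have j': "j \<in> {0<..<int p}" using j by auto
    \<comment> \<open>A nontrivial character sums to 0 over all residues, so the sums over
      \<open>S\<close> are the negatives of those over its complement.\<close>
    then have "\<not> int p dvd j" by (auto simp: zdvd_not_zless)
    then have \<alpha>\<beta>: "\<alpha> j = - (\<Sum>i\<in>missing p S False. unity_root p (j * i))"
      "\<beta> j = - (\<Sum>i\<in>missing p S True. unity_root p (j * i))"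
      using sum_unity_root[OF p_pos] by (simp_all add: \<alpha>_def \<beta>_def A_def B_def sum_not_missing)
    have "cmod l \<le> norm (\<alpha> j) + norm (\<beta> j)"
      by (rule norm_le_of_swap[OF F G j(2)]) auto
    then show ?thesis using j' by (auto simp: \<alpha>\<beta>)
  qed
qed

section \<open>Cayley subsets with prescribed complement and their explicit eigenvalues\<close>

definition complement_set :: "int set \<Rightarrow> int set \<Rightarrow> (int \<times> bool) set" where
  "complement_set A B = ({0..<int p} - A) \<times> {False} \<union> ({0..<int p} - B) \<times> {True}"

lemma missing_complement_set:
  assumes "A \<subseteq> {0..<int p}" "B \<subseteq> {0..<int p}"
  shows "missing p (complement_set A B) False = A" "missing p (complement_set A B) True = B"
  using assms by (auto simp: missing_def complement_set_def)

text \<open>The set generates for reasons of size: it has more than p elements, and a subgroup of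
  order above p in a group of order 2p is everything.\<close>

lemma cayley_subset_complement_set:
  assumes A: "A \<subseteq> {0..<int p}" "0 \<in> A" and B: "B \<subseteq> {0..<int p}"
    and sym: "\<And>i. i \<in> A \<Longrightarrow> (- i) mod int p \<in> A" and card: "card A + card B < p"
  shows "cayley_subset (dihedral p) (complement_set A B)"
proof -
  let ?S = "complement_set A B"
  interpret group "dihedral p" using p_pos by (rule group_dihedral)
  have S: "?S \<subseteq> carrier (dihedral p)" by (auto simp: complement_set_def dihedral_simps)
  have fin: "finite (carrier (dihedral p))" by (simp add: dihedral_simps)
  have inv: "inv\<^bsub>dihedral p\<^esub> s \<in> ?S" if "s \<in> ?S" for s
  proof -
    obtain i b where s: "s = (i, b)" by fastforce
    then have i: "i \<in> {0..<int p}" using that by (auto simp: complement_set_def)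
    show ?thesis
    proof (cases b)
      case True
      then show ?thesis using that s i by (simp add: dihedral_inv)
    next
      case False
      have "(- i) mod int p \<notin> A"
        using sym[of "(- i) mod int p"] that s i False by (auto simp: complement_set_def mod_simps)
      then show ?thesis using s i False p_pos by (simp add: dihedral_inv complement_set_def)
    qed
  qed
  have "m_inv (dihedral p) ` ?S = ?S"
  proof
    show "m_inv (dihedral p) ` ?S \<subseteq> ?S" using inv by auto
    show "?S \<subseteq> m_inv (dihedral p) ` ?S"
    proof
      fix s assume s: "s \<in> ?S"
      then have "s = inv\<^bsub>dihedral p\<^esub> (inv\<^bsub>dihedral p\<^esub> s)" using S by auto
      then show "s \<in> m_inv (dihedral p) ` ?S" using inv[OF s] by blast
    qed
  qed
  moreover have "generate (dihedral p) ?S = carrier (dihedral p)"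
  proof -
    let ?H = "generate (dihedral p) ?S"
    have H: "subgroup ?H (dihedral p)" using S by (rule generate_is_subgroup)
    then have HG: "?H \<subseteq> carrier (dihedral p)" by (rule subgroup.subset)
    have "card ?S \<le> card ?H"
      using finite_subset[OF HG fin] by (intro card_mono) (auto intro: generate.incl)
    moreover have "p < card ?S"
      using card_missing[OF S] missing_complement_set[OF A(1) B] card by simp
    moreover have "card ?H dvd 2 * p"
      using lagrange[OF H] order_dihedral[of p] by (metis dvd_triv_right)
    moreover have "card ?H = 2 * p" if gt: "p < card ?H" and dvd: "card ?H dvd 2 * p"
    proof -
      obtain c where c: "2 * p = card ?H * c" using dvd by (auto elim: dvdE)
      have "c < 2"
      proof (rule ccontr)
        assume "\<not> c < 2"
        then have "card ?H * 2 \<le> card ?H * c" by (intro mult_left_mono) auto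
        then show False using c gt by linarith
      qed
      moreover have "c \<noteq> 0" using c p_pos by (intro notI) simp
      ultimately have "c = 1" by simp
      then show ?thesis using c by simp
    qed
    ultimately have "card ?H = card (carrier (dihedral p))"
      using order_dihedral[of p] by (simp add: Coset.order_def)
    then show ?thesis using card_subset_eq[OF fin HG] by simp
  qed
  moreover have "\<one>\<^bsub>dihedral p\<^esub> \<notin> ?S" using A(2) by (auto simp: complement_set_def dihedral_simps)
  ultimately show ?thesis using S by (auto simp: cayley_subset_def)
qed

text \<open>The eigenfunction is the linear character that is 1 on rotations and -1 on
  reflections.\<close>

lemma adj_eigenvalue_sign:
  assumes S: "cayley_subset (dihedral p) S"
  shows "adj_eigenvalue (cayley_graph (dihedral p) S)
    (of_real (real (card (missing p S True)) - real (card (missing p S False))))"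
proof -
  interpret cayley "dihedral p" S by (rule cayley_dihedral[OF S])
  let ?l = "complex_of_real (real (card (missing p S True)) - real (card (missing p S False)))"
  define f :: "int \<times> bool \<Rightarrow> complex" where "f = (\<lambda>(i, b). if b then -1 else 1)"
  have c: "of_nat (card ({0..<int p} - missing p S b)) = of_nat p - (of_nat (card (missing p S b)) :: complex)" for b
    using card_Diff_subset[OF finite_missing missing_subset] card_mono[OF _ missing_subset, of p S b]
    by (simp add: of_nat_diff)
  have "(\<Sum>s\<in>S. f (v \<otimes>\<^bsub>dihedral p\<^esub> s)) = ?l * f v" for v
  proof -
    obtain i b where "v = (i, b)" by fastforce
    then show ?thesis
      by (cases b) (simp_all add: sum_dihedral_subset[OF S_carrier] dihedral_simps f_def c)
  qed
  moreover have "(0, False) \<in> carrier (dihedral p)" "f (0, False) \<noteq> 0"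
    using p_pos by (auto simp: dihedral_simps f_def)
  ultimately show ?thesis unfolding adj_eigenvalue_cayley_iff by blast
qed

text \<open>The eigenfunction is the root of unity with exponent i on both cosets. At reflections
  the conjugate sums occur, which agree with the original ones because \<open>u\<close> and
  \<open>v\<close> are real.\<close>

lemma adj_eigenvalue_unity_root:
  assumes S: "cayley_subset (dihedral p) S"
    and u: "(\<Sum>i\<in>missing p S False. unity_root p i) = of_real u"
    and v: "(\<Sum>i\<in>missing p S True. unity_root p i) = of_real v"
  shows "adj_eigenvalue (cayley_graph (dihedral p) S) (of_real (- (u + v)))"
proof -
  interpret cayley "dihedral p" S by (rule cayley_dihedral[OF S])
  define f :: "int \<times> bool \<Rightarrow> complex" where "f = (\<lambda>(i, b). unity_root p i)"
  have "\<not> int p dvd 1" using p by simp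
  then have 0: "(\<Sum>i\<in>{0..<int p}. unity_root p i) = 0" using sum_unity_root[OF p_pos, of 1] by simp
  have pos: "(\<Sum>i\<in>{0..<int p} - missing p S False. unity_root p i) = - of_real u"
    "(\<Sum>i\<in>{0..<int p} - missing p S True. unity_root p i) = - of_real v"
    by (simp_all add: sum_not_missing 0 u v)
  have neg: "(\<Sum>i\<in>{0..<int p} - missing p S False. unity_root p (- i)) = - of_real u"
    "(\<Sum>i\<in>{0..<int p} - missing p S True. unity_root p (- i)) = - of_real v"
    using pos[THEN arg_cong[of _ _ cnj]] by (simp_all add: unity_root_minus)
  have "(\<Sum>s\<in>S. f (w \<otimes>\<^bsub>dihedral p\<^esub> s)) = of_real (- (u + v)) * f w" for w
  proof -
    obtain i b where w: "w = (i, b)" by fastforce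
    have diff: "unity_root p (i - a) = unity_root p i * unity_root p (- a)" for a
      by (simp flip: unity_root_add)
    show ?thesis
      by (cases b) (simp_all add: w sum_dihedral_subset[OF S_carrier] dihedral_simps f_def
          unity_root_mod[OF p_pos] unity_root_add diff pos neg flip: sum_distrib_left, simp_all add: algebra_simps)
  qed
  moreover have "(0, False) \<in> carrier (dihedral p)" "f (0, False) \<noteq> 0"
    using p_pos by (auto simp: dihedral_simps f_def)
  ultimately show ?thesis unfolding adj_eigenvalue_cayley_iff by blast
qed

text \<open>Centring at 0 makes the interval closed under negation, as A must be, and its character
  sum real.\<close>

definition sym_interval :: "nat \<Rightarrow> int set" where
  "sym_interval h = (\<lambda>i. i mod int p) ` {- int h..int h}"

lemma sym_interval:
  assumes "2 * h < p"
  shows "sym_interval h \<subseteq> {0..<int p}" "0 \<in> sym_interval h" "card (sym_interval h) = 2 * h + 1"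
    "\<And>i. i \<in> sym_interval h \<Longrightarrow> (- i) mod int p \<in> sym_interval h"
    "(\<Sum>i\<in>sym_interval h. unity_root p i)
      = of_real (sin (pi * (2 * real h + 1) / real p) / sin (pi / real p))"
proof -
  have inj: "inj_on (\<lambda>i. i mod int p) {- int h..int h}"
  proof (rule inj_onI)
    fix x y assume xy: "x \<in> {- int h..int h}" "y \<in> {- int h..int h}" "x mod int p = y mod int p"
    then have "int p dvd x - y" by (simp add: mod_eq_dvd_iff)
    moreover have "\<bar>x - y\<bar> < int p" using xy assms by auto
    ultimately show "x = y" using dvd_imp_le_int[of "x - y" "int p"] by force
  qed
  show "sym_interval h \<subseteq> {0..<int p}" using p_pos by (auto simp: sym_interval_def)
  show "0 \<in> sym_interval h" by (auto simp: sym_interval_def image_iff intro!: bexI[of _ 0])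
  show "card (sym_interval h) = 2 * h + 1" using inj by (simp add: sym_interval_def card_image)
  show "(- i) mod int p \<in> sym_interval h" if i: "i \<in> sym_interval h" for i
  proof -
    obtain k where "k \<in> {- int h..int h}" "i = k mod int p" using i by (auto simp: sym_interval_def)
    then show ?thesis by (auto simp: sym_interval_def mod_simps intro!: image_eqI[of _ _ "- k"])
  qed
  show "(\<Sum>i\<in>sym_interval h. unity_root p i)
      = of_real (sin (pi * (2 * real h + 1) / real p) / sin (pi / real p))"
    using sum_unity_root_symmetric[of p h] p unity_root_mod[OF p_pos]
    by (simp add: sym_interval_def sum.reindex[OF inj] o_def)
qed

end

section \<open>Ramanujan covalencies\<close>

context
  fixes p :: nat
  assumes p: "prime p" "p > 2"
begin

lemma ramanujan_dihedral_iff: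
  assumes S: "cayley_subset (dihedral p) S" and L: "2 * p - card S = L" "L < 2 * p"
  shows "ramanujan (cayley_graph (dihedral p) S) \<longleftrightarrow>
    (\<forall>l. adj_eigenvalue (cayley_graph (dihedral p) S) l \<and> cmod l \<noteq> 2 * real p - real L
      \<longrightarrow> cmod l \<le> 2 * sqrt (2 * real p - real L - 1))"
proof -
  interpret cayley "dihedral p" S by (rule cayley_dihedral[OF p S])
  have "card S = 2 * p - L" using missing_cayley(3)[OF p S] L by linarith
  moreover from this have "S \<noteq> {}" using L by auto
  moreover have "real (2 * p - L) = 2 * real p - real L" using L by (simp add: of_nat_diff)
  ultimately show ?thesis using ramanujan_cayley_iff by simp
qed

lemma not_ramanujan_dihedralI:
  assumes S: "cayley_subset (dihedral p) S" and L: "2 * p - card S = L" "L < 2 * p"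
    and l: "adj_eigenvalue (cayley_graph (dihedral p) S) l" "cmod l \<noteq> 2 * real p - real L"
      "2 * sqrt (2 * real p - real L - 1) < cmod l"
  shows "\<not> ramanujan (cayley_graph (dihedral p) S)"
  unfolding ramanujan_dihedral_iff[OF S L] not_all using l by (intro exI[of _ l]) simp

lemma norm_sum_unity_root_le_card: "norm (\<Sum>i\<in>A. unity_root p (f i)) \<le> real (card A)"
  using norm_sum[of "\<lambda>i. unity_root p (f i)" A] by simp

text \<open>The degree is 2p - L, and (L+2)^2 <= 8p is equivalent to L^2 <= 4(2p - L - 1); hence the
  trivial bound L for nontrivial eigenvalues is good enough.\<close>

lemma ramanujan_small_covalency:
  assumes S: "cayley_subset (dihedral p) S" and L: "2 * p - card S = L" and le: "(L + 2)^2 \<le> 8 * p"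
  shows "ramanujan (cayley_graph (dihedral p) S)"
proof -
  let ?A = "missing p S False" and ?B = "missing p S True"
  have ab: "real L = real (card ?A) + real (card ?B)"
    using missing_cayley(3)[OF p S] L by linarith
  have "L^2 + 4 * L + 4 \<le> 8 * p" using le by (simp add: power2_eq_square algebra_simps)
  then have le': "real L^2 + 4 * real L + 4 \<le> 8 * real p"
    using of_nat_mono[of "L^2 + 4 * L + 4" "8 * p", where 'a = real] by simp
  then have "(real L)^2 \<le> 4 * (2 * real p - real L - 1)" by simp
  then have "real L \<le> sqrt (4 * (2 * real p - real L - 1))" by (rule real_le_rsqrt)
  then have sq: "real L \<le> 2 * sqrt (2 * real p - real L - 1)" by (simp only: real_sqrt_mult real_sqrt_four)
  have "4 * real L < 8 * real p" using le' zero_le_power2[of "real L"] by linarith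
  then have "L < 2 * p" by simp
  show ?thesis
    unfolding ramanujan_dihedral_iff[OF S L \<open>L < 2 * p\<close>]
  proof (intro allI impI)
    fix l assume "adj_eigenvalue (cayley_graph (dihedral p) S) l \<and> cmod l \<noteq> 2 * real p - real L"
    moreover have "2 * real p - real L = real (card S)"
      using missing_cayley(3)[OF p S] L \<open>L < 2 * p\<close> by linarith
    ultimately consider "cmod l \<le> \<bar>real (card ?B) - real (card ?A)\<bar>"
      | j where "cmod l \<le> norm (\<Sum>i\<in>?A. unity_root p (j * i)) + norm (\<Sum>i\<in>?B. unity_root p (j * i))"
      using adj_eigenvalue_dihedral_le[OF p S, of l] by auto
    then have "cmod l \<le> real L"
    proof cases
      case 2
      then show ?thesis
        using norm_sum_unity_root_le_card[of "\<lambda>i. j * i" ?A] norm_sum_unity_root_le_card[of "\<lambda>i. j * i" ?B] ab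
        by linarith
    qed (use ab in linarith)
    then show "cmod l \<le> 2 * sqrt (2 * real p - real L - 1)" using sq by linarith
  qed
qed

lemma sin_pi_div_p_pos: "sin (pi / real p) > 0"
  using p by (intro sin_gt_zero) (auto simp: field_simps)

text \<open>Two odd summands of \<open>L\<close> can be equal if \<open>L / 2\<close> is odd, and then \<open>\<kappa> = 1\<close>;
  otherwise they differ by at least \<open>2\<close>, and then \<open>\<kappa> = cos (\<pi> / p)\<close>.\<close>

lemma ramanujan_even_covalency:
  fixes \<kappa> :: real
  assumes S: "cayley_subset (dihedral p) S" and L: "2 * p - card S = L"
    and "even L" "L \<ge> 4" "L \<le> p" "(L + 1)^2 \<le> 8 * p"
    and \<kappa>: "0 \<le> \<kappa>" "\<And>a b :: nat. odd a \<Longrightarrow> odd b \<Longrightarrow> a + b = L \<Longrightarrow> cos ((real a - real b) / 2 * (pi / real p)) \<le> \<kappa>"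
    and le: "(sin (real L / 2 * (pi / real p)))^2 * \<kappa>^2 \<le> (2 * real p - real L - 1) * (sin (pi / real p))^2"
  shows "ramanujan (cayley_graph (dihedral p) S)"
proof -
  define A B where "A = missing p S False" and "B = missing p S True"
  define x where "x = pi / real p"
  have sx: "sin x > 0" using sin_pi_div_p_pos by (simp add: x_def)
  have "L < 2 * p" using \<open>L \<le> p\<close> p by simp
  have ab: "L = card A + card B"
    using missing_cayley(3)[OF p S] L by (simp add: A_def B_def)
  have odd: "odd (card A)" "odd (card B)"
    using missing_cayley(2)[OF p S] ab \<open>even L\<close> by (auto simp: A_def)
  have cS: "2 * real p - real L = real (card S)"
      using missing_cayley(3)[OF p S] L \<open>L < 2 * p\<close> by linarith
  have "L^2 + 2 * L + 1 \<le> 8 * p" using assms(6) by (simp add: power2_eq_square algebra_simps)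
  then have L2: "real L^2 + 2 * real L + 1 \<le> 8 * real p"
    using of_nat_mono[of "L^2 + 2 * L + 1" "8 * p", where 'a = real] by simp
  have L4: "real L \<ge> 4" using \<open>L \<ge> 4\<close> by simp
  have rt: "t \<le> 2 * sqrt (2 * real p - real L - 1)" if "t^2 \<le> 4 * (2 * real p - real L - 1)" for t
    using real_le_rsqrt[OF that] by (simp only: real_sqrt_mult real_sqrt_four)
  show ?thesis
    unfolding ramanujan_dihedral_iff[OF S L \<open>L < 2 * p\<close>]
  proof (intro allI impI)
    fix l assume "adj_eigenvalue (cayley_graph (dihedral p) S) l \<and> cmod l \<noteq> 2 * real p - real L"
    then consider "cmod l \<le> \<bar>real (card B) - real (card A)\<bar>"
      | j where "j \<in> {0<..<int p}" "cmod l \<le> norm (\<Sum>i\<in>A. unity_root p (j * i)) + norm (\<Sum>i\<in>B. unity_root p (j * i))"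
      using adj_eigenvalue_dihedral_le[OF p S, of l] cS unfolding A_def B_def by auto
    then show "cmod l \<le> 2 * sqrt (2 * real p - real L - 1)"
    proof cases
      case 1
      \<comment> \<open>Both cardinalities are odd, so |b - a| <= L - 2. The square of L - 2 is
        small enough because L^2 + 8 <= L^2 + 2L + 1 <= 8p.\<close>
      have "real (card A) \<ge> 1" "real (card B) \<ge> 1" using odd by (auto simp: Suc_le_eq odd_pos)
      then have "cmod l \<le> real L - 2" using 1 ab by auto
      also have "\<dots> \<le> 2 * sqrt (2 * real p - real L - 1)"
        using L2 L4 by (intro rt) (simp add: power2_eq_square algebra_simps)
      finally show ?thesis .
    next
      case 2
      have le1: "norm (\<Sum>i\<in>C. unity_root p (j * i)) \<le> sin (real (card C) * x) / sin x" if "C \<subseteq> {0..<int p}" for C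
        using norm_sum_unity_root_le[OF _ that coprime_p[OF p 2(1)]] p by (simp add: x_def mult.commute)
      have "cmod l \<le> (sin (real (card A) * x) + sin (real (card B) * x)) / sin x"
        using 2(2) le1[of A] le1[of B] missing_subset[of p S] unfolding A_def B_def add_divide_distrib
        by (meson add_mono order_trans)
      \<comment> \<open>Sum to product separates the fixed total L from the difference a - b, which
        is what \<open>\<kappa>\<close> controls.\<close>
      also have "sin (real (card A) * x) + sin (real (card B) * x)
        = 2 * sin (real L / 2 * x) * cos ((real (card A) - real (card B)) / 2 * x)"
        by (simp add: sin_plus_sin ab algebra_simps add_divide_distrib diff_divide_distrib)
      also have "\<dots> / sin x \<le> 2 * sin (real L / 2 * x) * \<kappa> / sin x"
      proof -
        have "real L / 2 * x \<le> pi"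
          using \<open>L \<le> p\<close> p by (simp add: x_def field_simps)
        then have "sin (real L / 2 * x) \<ge> 0" using p by (intro sin_ge_zero) (auto simp: x_def)
        moreover have "cos ((real (card A) - real (card B)) / 2 * x) \<le> \<kappa>"
          using \<kappa>(2)[OF odd] ab by (simp add: x_def)
        ultimately show ?thesis using sx by (intro divide_right_mono mult_left_mono) auto
      qed
      also have "\<dots> \<le> 2 * sqrt (2 * real p - real L - 1)"
      proof (rule rt)
        show "(2 * sin (real L / 2 * x) * \<kappa> / sin x)^2 \<le> 4 * (2 * real p - real L - 1)"
        proof -
          have "(2 * sin (real L / 2 * x) * \<kappa> / sin x)^2 = 4 * ((sin (real L / 2 * x))^2 * \<kappa>^2) / (sin x)^2"
            by (simp add: power_mult_distrib power_divide)
          also have "\<dots> \<le> 4 * ((2 * real p - real L - 1) * (sin x)^2) / (sin x)^2"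
            using le by (intro divide_right_mono mult_left_mono) (auto simp: x_def)
          also have "\<dots> = 4 * (2 * real p - real L - 1)" using sx by simp
          finally show ?thesis .
        qed
      qed
      finally show ?thesis .
    qed
  qed
qed

lemma cayley_sym_interval:
  assumes "2 * h + 1 + card B < p" "B \<subseteq> {0..<int p}"
  defines "S \<equiv> complement_set p (sym_interval p h) B"
  shows "cayley_subset (dihedral p) S" "missing p S False = sym_interval p h" "missing p S True = B"
    "2 * p - card S = 2 * h + 1 + card B"
proof -
  have h: "2 * h < p" using assms by simp
  note si = sym_interval[OF p h]
  show c: "cayley_subset (dihedral p) S"
    unfolding S_def using si assms by (intro cayley_subset_complement_set p) auto
  show m: "missing p S False = sym_interval p h" "missing p S True = B"
    unfolding S_def using si(1) assms(2) by (auto simp: missing_complement_set[OF p])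
  show "2 * p - card S = 2 * h + 1 + card B"
    using missing_cayley(3)[OF p c] m si(3) by simp
qed

text \<open>With B empty, the eigenvalue b - a reaches the trivial bound L = 2h+1, and 8p < (L+2)^2
  says that L is too large.\<close>

lemma not_ramanujan_odd_covalency:
  assumes "2 * h + 1 < p" "8 * p < (2 * h + 3)^2"
  shows "\<exists>S. cayley_subset (dihedral p) S \<and> 2 * p - card S = 2 * h + 1 \<and> \<not> ramanujan (cayley_graph (dihedral p) S)"
proof -
  define S where "S = complement_set p (sym_interval p h) {}"
  have S: "cayley_subset (dihedral p) S" "missing p S False = sym_interval p h" "missing p S True = {}"
    "2 * p - card S = 2 * h + 1"
    using cayley_sym_interval[of h "{}"] assms(1) by (auto simp: S_def)
  have card: "card (sym_interval p h) = 2 * h + 1" using assms(1) by (intro sym_interval(3) p) auto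
  define n where "n = 2 * real h + 1"
  have "real (8 * p) < real ((2 * h + 3)^2)" using assms(2) by (simp only: of_nat_less_iff)
  then have "8 * real p < (n + 2)^2" by (simp add: n_def add.commute)
  then have "4 * (2 * real p - n - 1) < n^2" by (simp add: power2_eq_square algebra_simps)
  then have "sqrt (4 * (2 * real p - n - 1)) < n" by (intro real_less_lsqrt) (auto simp: n_def)
  then have "2 * sqrt (2 * real p - n - 1) < n" by (simp only: real_sqrt_mult real_sqrt_four)
  then have less: "2 * sqrt (2 * real p - real (2 * h + 1) - 1) < n" by (simp add: n_def)
  have eig: "adj_eigenvalue (cayley_graph (dihedral p) S) (of_real (- n))"
    using adj_eigenvalue_sign[OF p S(1)] unfolding S card by (simp add: n_def add.commute)
  have norm: "cmod (of_real (- n)) = n" by (simp only: norm_of_real) (simp add: n_def)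
  \<comment> \<open>Since L < p, the modulus L differs from the degree 2p - L, so the eigenvalue
    counts.\<close>
  have "real (2 * h + 1) < real p" using assms(1) by (simp only: of_nat_less_iff)
  then have ne: "n \<noteq> 2 * real p - real (2 * h + 1)" by (simp add: n_def)
  have "2 * h + 1 < 2 * p" using assms(1) by simp
  then have "\<not> ramanujan (cayley_graph (dihedral p) S)"
    using less ne by (intro not_ramanujan_dihedralI[OF S(1,4) _ eig]) (simp_all only: norm not_False_eq_True)
  then show ?thesis using S by blast
qed

text \<open>A and B are centred intervals of lengths 2h+1 and 2h'+1. The eigenvalue -(u+v) is
  evaluated by sum to product, and the hypothesis compares its square with four times the degree
  minus one. It counts because its modulus is at most L < p < 2p - L.\<close>

lemma not_ramanujan_even_covalency:
  fixes h h' :: nat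
  assumes lt: "2 * h + 2 * h' + 2 < p"
    and less: "(2 * real p - (2 * real h + 2 * real h' + 2) - 1) * (sin (pi / real p))^2
      < (sin ((real h + real h' + 1) * (pi / real p)))^2 * (cos ((real h - real h') * (pi / real p)))^2"
  shows "\<exists>S. cayley_subset (dihedral p) S \<and> 2 * p - card S = 2 * h + 2 * h' + 2
    \<and> \<not> ramanujan (cayley_graph (dihedral p) S)"
proof -
  define S where "S = complement_set p (sym_interval p h) (sym_interval p h')"
  define x where "x = pi / real p"
  have sx: "sin x > 0" using sin_pi_div_p_pos by (simp add: x_def)
  have h: "2 * h < p" "2 * h' < p" using lt by auto
  note si = sym_interval[OF p h(1)] and si' = sym_interval[OF p h(2)]
  have S: "cayley_subset (dihedral p) S" "missing p S False = sym_interval p h"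
    "missing p S True = sym_interval p h'" "2 * p - card S = 2 * h + 2 * h' + 2"
    using cayley_sym_interval[of h "sym_interval p h'"] lt si' by (auto simp: S_def)
  define u v where "u = sin (pi * (2 * real h + 1) / real p) / sin (pi / real p)"
    and "v = sin (pi * (2 * real h' + 1) / real p) / sin (pi / real p)"
  define l where "l = complex_of_real (- (u + v))"
  have l: "adj_eigenvalue (cayley_graph (dihedral p) S) l"
    unfolding l_def by (rule adj_eigenvalue_unity_root[OF p S(1)]) (simp_all add: S si si' u_def v_def)
  define L where "L = 2 * real h + 2 * real h' + 2"
  have cl: "cmod l = \<bar>u + v\<bar>" unfolding l_def norm_of_real by (rule abs_minus_cancel)
  have "\<bar>u\<bar> \<le> 2 * real h + 1" "\<bar>v\<bar> \<le> 2 * real h' + 1"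
    using norm_sum_unity_root_le_card[of "\<lambda>i. i" "sym_interval p h"]
      norm_sum_unity_root_le_card[of "\<lambda>i. i" "sym_interval p h'"]
    unfolding si(3,5) si'(3,5) u_def v_def by (simp_all add: norm_of_real del: of_real_divide of_real_numeral)
  then have "cmod l \<le> L" unfolding cl L_def by linarith
  moreover have "real (2 * h + 2 * h' + 2) < real p" using lt by (simp only: of_nat_less_iff)
  then have "L < real p" by (simp add: L_def)
  ultimately have ne: "cmod l \<noteq> 2 * real p - L" by linarith
  have "u + v = 2 * sin ((real h + real h' + 1) * x) * cos ((real h - real h') * x) / sin x"
  proof -
    have "sin (pi * (2 * real h + 1) / real p) + sin (pi * (2 * real h' + 1) / real p)
      = sin ((2 * real h + 1) * x) + sin ((2 * real h' + 1) * x)" by (simp add: x_def mult.commute)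
    also have "\<dots> = 2 * sin ((real h + real h' + 1) * x) * cos ((real h - real h') * x)"
      by (simp add: sin_plus_sin algebra_simps add_divide_distrib diff_divide_distrib)
    finally show ?thesis unfolding u_def v_def x_def by (simp only: flip: add_divide_distrib)
  qed
  then have "(u + v)^2 = 4 * ((sin ((real h + real h' + 1) * x))^2 * (cos ((real h - real h') * x))^2) / (sin x)^2"
    by (simp add: power_mult_distrib power_divide)
  moreover have "4 * (2 * real p - L - 1) * (sin x)^2
    < 4 * ((sin ((real h + real h' + 1) * x))^2 * (cos ((real h - real h') * x))^2)"
    unfolding mult.assoc by (rule mult_strict_left_mono) (use less in \<open>simp_all add: L_def x_def\<close>)
  ultimately have "4 * (2 * real p - L - 1) < (u + v)^2" using sx by (simp add: less_divide_eq)
  then have "4 * (2 * real p - L - 1) < (cmod l)^2" by (simp add: cl)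
  then have "sqrt (4 * (2 * real p - L - 1)) < cmod l" by (intro real_less_lsqrt) auto
  then have "2 * sqrt (2 * real p - L - 1) < cmod l" by (simp only: real_sqrt_mult real_sqrt_four)
  moreover have L: "real (2 * h + 2 * h' + 2) = L" and "2 * h + 2 * h' + 2 < 2 * p"
    using lt by (auto simp: L_def)
  ultimately have "\<not> ramanujan (cayley_graph (dihedral p) S)"
    using ne by (intro not_ramanujan_dihedralI[OF S(1,4) _ l]) (simp_all only: L not_False_eq_True)
  then show ?thesis using S by blast
qed

section \<open>The values of \<open>l_tilde\<close> and \<open>l_hat\<close>\<close>

text \<open>Up to 2m-1 the trivial bound works and 2m+1 has a counterexample, so only covalency 2m
  is undecided.\<close>

lemma l_tilde_eq_iff:
  fixes m :: nat
  assumes "(2 * m + 1)^2 \<le> 8 * p" "8 * p < (2 * m + 2)^2" "2 * m + 1 < p" "m \<ge> 1"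
  shows "l_tilde p = 2 * m \<longleftrightarrow>
    (\<forall>S. cayley_subset (dihedral p) S \<and> 2 * p - card S = 2 * m \<longrightarrow> ramanujan (cayley_graph (dihedral p) S))"
    (is "_ \<longleftrightarrow> ?R")
proof -
  define M where "M = {l \<in> dihedral_covalencies p.
     \<forall>S. cayley_subset (dihedral p) S \<and> 1 \<le> 2 * p - card S \<and> 2 * p - card S \<le> l \<longrightarrow>
       ramanujan (cayley_graph (dihedral p) S)}"
  have lt: "l_tilde p = Max M" by (simp add: l_tilde_def M_def)
  have small: "ramanujan (cayley_graph (dihedral p) S)"
    if "cayley_subset (dihedral p) S" "2 * p - card S \<le> 2 * m - 1" for S
  proof (rule ramanujan_small_covalency[OF that(1) refl])
    have "2 * p - card S + 2 \<le> 2 * m + 1" using that(2) \<open>m \<ge> 1\<close> by linarith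
    then have "(2 * p - card S + 2)^2 \<le> (2 * m + 1)^2" by (rule power_mono) simp
    then show "(2 * p - card S + 2)^2 \<le> 8 * p" using assms(1) by linarith
  qed
  obtain S where S: "cayley_subset (dihedral p) S" "2 * p - card S = 2 * m + 1"
    "\<not> ramanujan (cayley_graph (dihedral p) S)"
  proof -
    have "(2 * m + 2)^2 \<le> (2 * m + 3)^2" by (rule power_mono) auto
    then have "8 * p < (2 * m + 3)^2" using assms(2) by linarith
    then show ?thesis using not_ramanujan_odd_covalency[of m] assms(3) that by blast
  qed
  have le: "l \<le> 2 * m" if "l \<in> M" for l
  proof (rule ccontr)
    assume "\<not> l \<le> 2 * m"
    then have "ramanujan (cayley_graph (dihedral p) S)" using that S by (auto simp: M_def)
    then show False using S by simp
  qed
  then have fin: "finite M" by (meson finite_atMost finite_subset atMost_iff subsetI)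
  \<comment> \<open>The witness has an interval of length 2m-1 for A and empty B; adding one
    reflection to the complement gives covalency 2m below.\<close>
  have "2 * m - 1 \<in> M"
  proof -
    have "2 * m - 1 \<in> dihedral_covalencies p"
      using cayley_sym_interval(1,4)[of "m - 1" "{}"] assms(3,4)
      unfolding dihedral_covalencies_def by (intro CollectI exI[of _ "complement_set p (sym_interval p (m - 1)) {}"]) auto
    then show ?thesis using small by (auto simp: M_def)
  qed
  then have ne: "M \<noteq> {}" by auto
  have cov: "2 * m \<in> dihedral_covalencies p"
  proof -
    have si: "sym_interval p 0 \<subseteq> {0..<int p}" "card (sym_interval p 0) = 1"
      using sym_interval[OF p, of 0] p by auto
    then show ?thesis
      using cayley_sym_interval(1,4)[of "m - 1" "sym_interval p 0"] assms(3,4)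
      unfolding dihedral_covalencies_def
      by (intro CollectI exI[of _ "complement_set p (sym_interval p (m - 1)) (sym_interval p 0)"]) auto
  qed
  show ?thesis
  proof
    assume "l_tilde p = 2 * m"
    then have "2 * m \<in> M" using Max_in[OF fin ne] lt by simp
    then show ?R using \<open>m \<ge> 1\<close> by (auto simp: M_def)
  next
    assume R: ?R
    have "2 * m \<in> M"
      unfolding M_def
    proof (intro CollectI conjI cov allI impI)
      fix S assume S: "cayley_subset (dihedral p) S \<and> 1 \<le> 2 * p - card S \<and> 2 * p - card S \<le> 2 * m"
      then show "ramanujan (cayley_graph (dihedral p) S)"
        using R small[of S] by (cases "2 * p - card S = 2 * m") auto
    qed
    then show "l_tilde p = 2 * m" unfolding lt using le fin by (intro Max_eqI) auto
  qed
qed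

end

text \<open>Here sqrt(2p) - 1/2 lies between m and m + 1/2. With an odd floor, being exceptional
  therefore means \<open>l_tilde p = 2 * m\<close>.\<close>

lemma l_hat_eq:
  assumes "\<lfloor>2 * sqrt (2 * real p)\<rfloor> = 2 * m + 1"
  shows "l_hat p = 2 * m - 1"
proof -
  have "real_of_int (2 * m + 1) \<le> 2 * sqrt (2 * real p)" "2 * sqrt (2 * real p) < real_of_int (2 * m + 1) + 1"
    using assms by linarith+
  then have "\<lfloor>sqrt (2 * real p) - 1 / 2\<rfloor> = m" by (intro floor_unique) auto
  then show ?thesis by (simp add: l_hat_def)
qed

lemma floor_two_sqrt_eq:
  assumes "\<lfloor>2 * sqrt (2 * real p)\<rfloor> = F" "F \<ge> 0"
  shows "F^2 \<le> 8 * int p" "8 * int p < (F + 1)^2"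
proof -
  have sq: "(2 * sqrt (2 * real p))^2 = 8 * real p" by (simp add: power_mult_distrib)
  have *: "real_of_int F \<le> 2 * sqrt (2 * real p)" "2 * sqrt (2 * real p) < real_of_int F + 1"
    using assms by linarith+
  have "(real_of_int F)^2 \<le> (2 * sqrt (2 * real p))^2" using * assms(2) by (intro power_mono) auto
  then have "real_of_int (F^2) \<le> real_of_int (8 * int p)" by (simp add: sq)
  then show "F^2 \<le> 8 * int p" by (simp only: of_int_le_iff)
  have "(2 * sqrt (2 * real p))^2 < (real_of_int F + 1)^2" using * by (intro power_strict_mono) auto
  then have "real_of_int (8 * int p) < real_of_int ((F + 1)^2)" by (simp add: sq)
  then show "8 * int p < (F + 1)^2" by (simp only: of_int_less_iff)
qed

section \<open>Matching the critical covalency with the polynomial families\<close>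

theorem theorem4p5:
  fixes p :: nat and k r :: int
  assumes "prime p" and "p \<ge> 29"
    and "odd \<lfloor>2 * sqrt (2 * real p)\<rfloor>"
    and "k \<ge> 0" and "r \<in> {1, 3}"
    and "\<lfloor>2 * sqrt (2 * real p)\<rfloor> - 2 = 4 * k + r"
  shows "exceptional p \<longleftrightarrow> (\<exists>c\<in>C_set r. \<exists>n::int. n \<ge> k_min r c \<and> int p = f_poly r c n)"
proof -
  have p: "prime p" "p > 2" using assms by auto
  define F where "F = 4 * k + r + 2"
  have F: "\<lfloor>2 * sqrt (2 * real p)\<rfloor> = F" using assms by (simp add: F_def)
  have F0: "F \<ge> 0" using assms by (auto simp: F_def)
  note sq = floor_two_sqrt_eq[OF F F0]
  \<comment> \<open>Otherwise 8p < 15^2 = 225, whereas p >= 29 gives 8p >= 232. This yields k >=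
    3.\<close>
  have "F \<ge> 15"
  proof (rule ccontr)
    assume "\<not> F \<ge> 15"
    then have "(F + 1)^2 \<le> 15^2" using F0 by (intro power_mono) auto
    then show False using sq assms(2) by simp
  qed
  then have k3: "k \<ge> 3" using assms(5) by (auto simp: F_def)
  \<comment> \<open>The critical covalency is 2m = F - 1.\<close>
  define m where "m = nat ((4 * k + r + 1) div 2)"
  have m: "2 * int m = 4 * k + r + 1" using assms by (auto simp: m_def)
  then have Fm: "F = 2 * int m + 1" by (simp add: F_def)
  have "int ((2 * m + 1)^2) \<le> int (8 * p)" "int (8 * p) < int ((2 * m + 2)^2)"
    using sq by (simp_all add: Fm add.commute)
  then have m1: "(2 * m + 1)^2 \<le> 8 * p" and m2: "8 * p < (2 * m + 2)^2"
    by (simp_all only: of_nat_le_iff of_nat_less_iff)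
  have m3: "2 * m + 1 < p"
  proof (rule ccontr)
    assume "\<not> 2 * m + 1 < p"
    then have "p^2 \<le> (2 * m + 1)^2" by (intro power_mono) auto
    then have "p^2 \<le> 8 * p" using m1 by linarith
    then have "p \<le> 8" using p by (simp add: power2_eq_square)
    then show False using assms(2) by simp
  qed
  have m4: "m \<ge> 1" using m k3 assms(5) by auto
  have podd: "odd p" using p prime_odd_nat by auto
  have exc: "exceptional p \<longleftrightarrow>
    (\<forall>S. cayley_subset (dihedral p) S \<and> 2 * p - card S = 2 * m \<longrightarrow> ramanujan (cayley_graph (dihedral p) S))"
  proof -
    have "exceptional p \<longleftrightarrow> int (l_tilde p) = 2 * int m"
      using assms(3) l_hat_eq[of p "int m"] F Fm by (simp add: exceptional_def)
    also have "\<dots> \<longleftrightarrow> l_tilde p = 2 * m" by linarith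
    finally show ?thesis using l_tilde_eq_iff[OF p m1 m2 m3 m4] by simp
  qed
  have mp: "2 * m \<le> p" "(2 * m + 1)^2 \<le> 8 * p" "2 * m \<ge> 4" using m1 m3 m k3 assms(5) by auto
  define K where "K = nat k"
  have K: "real K = real_of_int k" using k3 by (simp add: K_def)
  have pR: "real p = real_of_int (int p)" by simp
  from assms(5) consider "r = 1" | "r = 3" by auto
  then show ?thesis
  proof cases
    case 1
    define c where "c = int p - 2 * k^2 - 4 * k"
    have pc: "int p = 2 * k^2 + 4 * k + c" by (simp add: c_def)
    \<comment> \<open>Parity together with c <= 1 leaves -3, -1, 1 or c <= -5.\<close>
    have "odd c" using podd pc by (metis even_add even_mult_iff even_numeral even_of_nat)
    have "(4 * k + 3)^2 \<le> 8 * int p" "8 * int p < (4 * k + 4)^2" using sq by (simp_all add: F_def 1 add.commute)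
    then have c1: "8 * c \<ge> 9 - 8 * k" "c \<le> 1" by (simp_all add: pc power2_eq_square algebra_simps)
    have rhs: "(\<exists>c\<in>C_set r. \<exists>n::int. n \<ge> k_min r c \<and> int p = f_poly r c n) \<longleftrightarrow> c \<in> {-3, -1, 1}"
    proof
      assume "\<exists>c\<in>C_set r. \<exists>n::int. n \<ge> k_min r c \<and> int p = f_poly r c n"
      then obtain c' n where "c' \<in> C_set r" "n \<ge> k_min r c'" "int p = f_poly r c' n" by blast
      then have c': "c' \<in> {-3, -1, 1}" "n \<ge> (if c' = -3 then 5 else 3)" and pn: "int p = 2 * n^2 + 4 * n + c'"
        by (simp_all add: 1 C_set_def k_min_def f_poly_def)
      \<comment> \<open>Any representation by the family locates the root of 8p between 4n+3 and
        4n+4, which forces n = k.\<close>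
      have "(4 * n + 3)^2 \<le> 8 * int p" "8 * int p < (4 * n + 4)^2"
        using c' by (auto simp: pn power2_eq_square algebra_simps split: if_splits)
      then have "(4 * n + 3)^2 < (4 * k + 4)^2" "(4 * k + 3)^2 < (4 * n + 4)^2"
        using \<open>(4 * k + 3)^2 \<le> 8 * int p\<close> \<open>8 * int p < (4 * k + 4)^2\<close> by linarith+
      moreover have "0 \<le> 4 * k + 4" "0 \<le> 4 * n + 4" using k3 c'(2) by (auto split: if_splits)
      ultimately have "4 * n + 3 < 4 * k + 4" "4 * k + 3 < 4 * n + 4"
        using power2_less_imp_less by blast+
      then have "n = k" by simp
      then show "c \<in> {-3, -1, 1}" using pn pc c' by simp
    next
      assume "c \<in> {-3, -1, 1}"
      \<comment> \<open>For c = -3 the bound 8c >= 9 - 8k already forces k >= 5.\<close>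
      then have "c \<in> C_set r" "k \<ge> k_min r c" "int p = f_poly r c k"
        using c1 k3 pc by (auto simp: 1 C_set_def k_min_def f_poly_def)
      then show "\<exists>c\<in>C_set r. \<exists>n::int. n \<ge> k_min r c \<and> int p = f_poly r c n" by blast
    qed
    have P: "real p = 2 * (real_of_int k)^2 + 4 * real_of_int k + real_of_int c"
      unfolding pR pc by simp
    \<comment> \<open>Here m is odd, so A and B can both have m elements; this is the case
      \<open>\<kappa> = 1\<close>, and the counterexample below uses two equal intervals of length
      2K+1.\<close>
    have mK: "m = 2 * K + 1" using m 1 k3 by (simp add: K_def)
    then have mk: "real (2 * m) = 4 * real_of_int k + 2" by (simp add: K)
    have coef: "2 * real p - real (2 * m) - 1 = (2 * real_of_int k + 1)^2 + 2 * real_of_int c - 4"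
      unfolding mk P by (simp add: power2_eq_square algebra_simps)
    show ?thesis
    proof (cases "c \<in> {-3, -1, 1}")
      case True
      have "(sin ((2 * real_of_int k + 1) * (pi / real p)))^2
        \<le> ((2 * real_of_int k + 1)^2 + 2 * real_of_int c - 4) * (sin (pi / real p))^2"
        unfolding P using True c1 k3 by (intro sin_odd_multiple_le) auto
      moreover have "real (2 * m) / 2 = 2 * real_of_int k + 1" unfolding mk by simp
      ultimately have "ramanujan (cayley_graph (dihedral p) S)"
        if "cayley_subset (dihedral p) S" "2 * p - card S = 2 * m" for S
        using that mp by (intro ramanujan_even_covalency[OF p that, where \<kappa> = 1]) (auto simp only: coef, auto)
      then show ?thesis using True exc rhs by blast
    next
      case False
      then have "c \<le> -5" using c1 \<open>odd c\<close> by (auto, presburger)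
      then have "k \<ge> 7" using c1 by linarith
      then have kR: "real_of_int k \<ge> 7" "9 - 8 * real_of_int k \<le> 8 * real_of_int c"
        using of_int_le_iff[of "9 - 8 * k" "8 * c", where 'a = real] c1 by auto
      have less: "((2 * real_of_int k + 1)^2 + 2 * real_of_int c - 4) * (sin (pi / real p))^2
        < (sin ((2 * real_of_int k + 1) * (pi / real p)))^2"
        unfolding P using kR \<open>c \<le> -5\<close> by (intro less_sin_odd_multiple) auto
      have "\<exists>S. cayley_subset (dihedral p) S \<and> 2 * p - card S = 2 * K + 2 * K + 2
        \<and> \<not> ramanujan (cayley_graph (dihedral p) S)"
      proof (intro not_ramanujan_even_covalency p)
        have "2 * real K + 2 * real K + 2 = real (2 * m)" "real K + real K + 1 = 2 * real_of_int k + 1"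
          by (simp_all add: mK K)
        then show "(2 * real p - (2 * real K + 2 * real K + 2) - 1) * (sin (pi / real p))^2
          < (sin ((real K + real K + 1) * (pi / real p)))^2 * (cos ((real K - real K) * (pi / real p)))^2"
          using less by (simp only: coef) simp
      qed (use m3 mK in simp)
      moreover have "2 * K + 2 * K + 2 = 2 * m" by (simp add: mK)
      ultimately show ?thesis using False exc rhs by metis
    qed
  next
    case 2
    define c where "c = int p - 2 * k^2 - 6 * k"
    have pc: "int p = 2 * k^2 + 6 * k + c" by (simp add: c_def)
    have "odd c" using podd pc by (metis even_add even_mult_iff even_numeral even_of_nat)
    have "(4 * k + 5)^2 \<le> 8 * int p" "8 * int p < (4 * k + 6)^2" using sq by (simp_all add: F_def 2 add.commute)
    then have c1: "8 * c \<ge> 25 - 8 * k" "c \<le> 4" by (simp_all add: pc power2_eq_square algebra_simps)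
    then have c3: "c \<le> 3" using \<open>odd c\<close> by presburger
    have rhs: "(\<exists>c\<in>C_set r. \<exists>n::int. n \<ge> k_min r c \<and> int p = f_poly r c n)
      \<longleftrightarrow> c = -1 \<and> k \<ge> 7 \<or> c = 1 \<or> c = 3"
    proof
      assume "\<exists>c\<in>C_set r. \<exists>n::int. n \<ge> k_min r c \<and> int p = f_poly r c n"
      then obtain c' n where "c' \<in> C_set r" "n \<ge> k_min r c'" "int p = f_poly r c' n" by blast
      then have c': "c' \<in> {-1, 1, 3}" "n \<ge> (if c' = -1 then 7 else 3)" and pn: "int p = 2 * n^2 + 6 * n + c'"
        by (simp_all add: 2 C_set_def k_min_def f_poly_def)
      have "(4 * n + 5)^2 \<le> 8 * int p" "8 * int p < (4 * n + 6)^2"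
        using c' by (auto simp: pn power2_eq_square algebra_simps split: if_splits)
      then have "(4 * n + 5)^2 < (4 * k + 6)^2" "(4 * k + 5)^2 < (4 * n + 6)^2"
        using \<open>(4 * k + 5)^2 \<le> 8 * int p\<close> \<open>8 * int p < (4 * k + 6)^2\<close> by linarith+
      moreover have "0 \<le> 4 * k + 6" "0 \<le> 4 * n + 6" using k3 c'(2) by (auto split: if_splits)
      ultimately have "4 * n + 5 < 4 * k + 6" "4 * k + 5 < 4 * n + 6"
        using power2_less_imp_less by blast+
      then have "n = k" by simp
      then show "c = -1 \<and> k \<ge> 7 \<or> c = 1 \<or> c = 3" using pn pc c' by (auto split: if_splits)
    next
      assume "c = -1 \<and> k \<ge> 7 \<or> c = 1 \<or> c = 3"
      then have "c \<in> C_set r" "k \<ge> k_min r c" "int p = f_poly r c k"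
        using c1 k3 pc by (auto simp: 2 C_set_def k_min_def f_poly_def)
      then show "\<exists>c\<in>C_set r. \<exists>n::int. n \<ge> k_min r c \<and> int p = f_poly r c n" by blast
    qed
    have P: "real p = 2 * (real_of_int k)^2 + 6 * real_of_int k + real_of_int c"
      unfolding pR pc by simp
    have mK: "m = 2 * K + 2" using m 2 k3 by (simp add: K_def)
    then have mk: "real (2 * m) = 4 * real_of_int k + 4" by (simp add: K)
    have coef: "2 * real p - real (2 * m) - 1 = (2 * real_of_int k + 2)^2 + 2 * real_of_int c - 9"
      unfolding mk P by (simp add: power2_eq_square algebra_simps)
    show ?thesis
    proof (cases "c = -1 \<and> k \<ge> 7 \<or> c = 1 \<or> c = 3")
      case True
      have le: "(sin ((2 * real_of_int k + 2) * (pi / real p)))^2 * (cos (pi / real p))^2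
        \<le> ((2 * real_of_int k + 2)^2 + 2 * real_of_int c - 9) * (sin (pi / real p))^2"
        unfolding P using True c1 k3 by (intro sin_cos_even_multiple_le) auto
      have half: "real (2 * m) / 2 = 2 * real_of_int k + 2" unfolding mk by simp
      have cos0: "0 \<le> cos (pi / real p)"
        using p by (intro less_imp_le cos_gt_zero) (auto simp: field_simps)
      \<comment> \<open>Now m is even, so two odd numbers with sum 2m are unequal: half their
        difference is a nonzero (in fact odd) integer, and the cosine is at most cos(pi/p).\<close>
      have cos_le: "cos ((real a - real b) / 2 * (pi / real p)) \<le> cos (pi / real p)"
        if ab: "odd a" "odd b" "a + b = 2 * m" for a b :: nat
      proof -
        define d where "d = (int a - int b) div 2"
        have d: "int a - int b = 2 * d" using ab by (simp add: d_def)
        then have "int m = d + int b" using ab(3) by linarith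
        then have "odd d" using ab(2) mK by presburger
        then have "\<bar>d\<bar> \<ge> 1" by presburger
        moreover have "\<bar>d\<bar> \<le> int p" using d ab(3) mp(1) by linarith
        ultimately have d': "1 \<le> \<bar>real_of_int d\<bar>" "\<bar>real_of_int d\<bar> \<le> real p" by linarith+
        have "(real a - real b) / 2 = real_of_int d"
          using arg_cong[OF d, of real_of_int] by simp
        then have "cos ((real a - real b) / 2 * (pi / real p)) = cos (\<bar>real_of_int d\<bar> * (pi / real p))"
          by (cases "d \<ge> 0") auto
        also have "\<dots> \<le> cos (pi / real p)"
          using d' p by (intro cos_monotone_0_pi_le) (auto simp: field_simps)
        finally show ?thesis .
      qed
      have "ramanujan (cayley_graph (dihedral p) S)"
        if S: "cayley_subset (dihedral p) S" "2 * p - card S = 2 * m" for S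
        using mp cos0 cos_le le
        by (intro ramanujan_even_covalency[OF p S, where \<kappa> = "cos (pi / real p)"]) (simp_all only: coef half, simp_all)
      then show ?thesis using True exc rhs by blast
    next
      case False
      have less: "((2 * real_of_int k + 2)^2 + 2 * real_of_int c - 9) * (sin (pi / real p))^2
        < (sin ((2 * real_of_int k + 2) * (pi / real p)))^2 * (cos (pi / real p))^2"
      proof (cases "c = -1")
        case True
        \<comment> \<open>The bound 8c >= 25 - 8k gives k >= 5 at c = -1, leaving just p = 79 and p
          = 107.\<close>
        then have "k = 5 \<or> k = 6" using False c1 by auto
        then have "2 * real_of_int k + 2 = 12 \<and> real p = 79 \<or> 2 * real_of_int k + 2 = 14 \<and> real p = 107"
          using True P by auto
        from less_sin_cos_multiple_79_107[OF this] show ?thesis using True by simp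
      next
        case neq: False
        then have "c \<le> -3" using False c3 \<open>odd c\<close> by presburger
        then have "k \<ge> 7" using c1 by linarith
        then have "real_of_int k \<ge> 7" "25 - 8 * real_of_int k \<le> 8 * real_of_int c"
          using of_int_le_iff[of "25 - 8 * k" "8 * c", where 'a = real] c1 by auto
        then show ?thesis
          unfolding P using \<open>c \<le> -3\<close> by (intro less_sin_cos_even_multiple) auto
      qed
      \<comment> \<open>The extremal intervals have the nearly equal odd lengths 2K+1 and
        2K+3.\<close>
      have "\<exists>S. cayley_subset (dihedral p) S \<and> 2 * p - card S = 2 * K + 2 * (K + 1) + 2
        \<and> \<not> ramanujan (cayley_graph (dihedral p) S)"
      proof (intro not_ramanujan_even_covalency p)
        have "2 * real K + 2 * real (K + 1) + 2 = real (2 * m)"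
          "real K + real (K + 1) + 1 = 2 * real_of_int k + 2"
          "cos ((real K - real (K + 1)) * (pi / real p)) = cos (pi / real p)"
          by (simp_all add: mK K)
        then show "(2 * real p - (2 * real K + 2 * real (K + 1) + 2) - 1) * (sin (pi / real p))^2
          < (sin ((real K + real (K + 1) + 1) * (pi / real p)))^2
            * (cos ((real K - real (K + 1)) * (pi / real p)))^2"
          using less by (simp only: coef)
      qed (use m3 mK in simp)
      moreover have "2 * K + 2 * (K + 1) + 2 = 2 * m" by (simp add: mK)
      ultimately show ?thesis using False exc rhs by metis
    qed
  qed
qed

end
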